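(* Let $m,n\ge1$, $\mathfrak g=\mathfrak{gl}(m,n)$, $\eta=\epsilon_1-\delta_n$, and let $\mathfrak b$ be a Borel subalgebra of $\mathfrak g$ with the same even part as the distinguished Borel subalgebra, given by a shuffle $(x_1,\dots,x_{m+n})$ with $x_1=1$ and $x_{m+n}=n'$. Set $$\Theta_\eta=\sum_{J\in\mathbb I}f_JH_J .$$ Then $\Theta_\eta$ is a Šapovalov element for the pair $(\eta,1)$ with respect to the Borel subalgebra $\mathfrak b$.
   Context: Ground field $\mathbb C$. Index rows and columns of $\mathfrak g=\mathfrak{gl}(m,n)$ by $\|m+n\|=\{1,\dots,m,1',\dots,n'\}$, with $j'$ standing for $m+j$; $e_{a,b}$ are the matrix units, even iff $a,b$ are both primed or both unprimed. $\mathfrak h$ is the diagonal subalgebra, $\epsilon_i,\delta_j\in\mathfrak h^*$ the basis dual to $e_{i,i}$, $e_{j',j'}$, with $(\epsilon_i,\epsilon_j)=\delta_{ij}=-(\delta_i,\delta_j)$, $(\epsilon_i,\delta_j)=0$; $h_\alpha\in\mathfrak h$ is defined by $\beta(h_\alpha)=(\alpha,\beta)$ for all $\beta\in\mathfrak h^*$. Borel subalgebras with the same even part as the distinguished (upper triangular) one correspond to shuffles: orderings $(x_1,\dots,x_{m+n})$ of $\|m+n\|$ in which $1,\dots,m$ and $1',\dots,n'$ are subsequences. Write $\chi_i=\epsilon_i$, $\chi_{j'}=\delta_j$. The Borel $\mathfrak b$ has positive roots $\Delta^+=\{\chi_{x_p}-\chi_{x_q}:p<q\}$ and simple roots $\Pi=\{\alpha_k=\chi_{x_k}-\chi_{x_{k+1}}:1\le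 k\le m+n-1\}$; $\mathfrak n^+$ (resp. $\mathfrak n^-$) is spanned by the $e_{x_p,x_q}$ with $p<q$ (resp. $p>q$), $\mathfrak b^-=\mathfrak h\oplus\mathfrak n^-$, and $\rho=\frac12\sum_{\Delta_0^+}\alpha-\frac12\sum_{\Delta_1^+}\alpha$ (even, odd positive roots of $\mathfrak b$). Let $i(k)$ be the number of $j<k$ with $\alpha_j$ odd ($1\le k\le m+n$). Let $h_k=h_{\alpha_k}$ and $s_k=h_1+\dots+h_k$. Let $\ell(k)$ be the number of $i\in\{1,\dots,k-1\}$ with $\alpha_i$ a root of $0\oplus\mathfrak{gl}(n)$ minus the number of $i\in\{1,\dots,k-1\}$ with $\alpha_i$ a root of $\mathfrak{gl}(m)\oplus0$. Let $\bar i(k)=(1-(-1)^{i(k)})/2\in\{0,1\}$ and $d_k=\ell(k)+\bar i(k)$. For $1\le j\le m+n-2$ and $e=x_{j+1}$ put $t_e=(-1)^{i(j+1)}(s_j-d_j)\in U(\mathfrak h)$. $\mathbb I=\{I\subseteq\|m+n\|:1,n'\in I\}$. For $I=\{x_{p_0},x_{p_1},\dots,x_{p_{s+1}}\}$ with $p_0=m+n>p_1>\dots>p_{s+1}=1$, $f_I=e_{x_{p_0},x_{p_1}}e_{x_{p_1},x_{p_2}}\cdots e_{x_{p_s},x_{p_{s+1}}}$ and $H_I=\prod_{e\in\|m+n\|\setminus I}t_e$ (empty product $=1$). Šapovalov element for $(\eta,1)$ with respect to $\mathfrak b$: an element $\theta\in U(\mathfrak b^-)$ of weight $-\eta$ of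 the form $\theta=\sum_\pi e_{-\pi}H_\pi$, $H_\pi\in U(\mathfrak h)$, where $\pi$ runs over partitions of $\eta$ (functions $\pi:\Delta^+\to\mathbb Z_{\ge0}$ with $\sum\pi(\alpha)\alpha=\eta$, $\pi(\alpha)\le1$ for $\alpha$ odd), $e_{-\pi}$ is the product of the $e_{-\alpha}^{\pi(\alpha)}$ in a fixed order on $\Delta^+$ (the $f_J$ are such monomials), with $H_{\pi^0}=1$ for the partition $\pi^0$ vanishing off $\Pi$, and $e_\alpha\theta\in U(\mathfrak g)(h_\eta+\rho(h_\eta))+U(\mathfrak g)\mathfrak n^+$ for all $\alpha\in\Delta^+$. *)

theory Defs
  imports "HOL-Analysis.Analysis" "HOL-Library.Poly_Mapping" "HOL-Library.Sublist"
begin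

section \<open>The universal enveloping algebra of \<open>\<gg>\<ll>(m,n)\<close>\<close>

text \<open>
  The numbers \<open>m, n \<ge> 1\<close> are the cardinalities of two finite linearly ordered types
  \<open>'m\<close>, \<open>'n\<close>. The index set of rows and columns is the type \<open>'m + 'n\<close>; \<open>Inl i\<close> is the
  unprimed index \<open>i\<close>, and \<open>Inr j\<close> is the primed index \<open>j'\<close>.

  Finitely supported functions on the free monoid of words, with the convolution product of
  \<open>Poly_Mapping\<close>, form the free associative algebra on the letters.
\<close>

datatype 'a fword = FWord (letters: "'a list")

instantiation fword :: (type) monoid_add
begin
definition zero_fword :: "'a fword" where "0 = FWord []"
definition plus_fword :: "'a fword \<Rightarrow> 'a fword \<Rightarrow> 'a fword" where
  "v + w = FWord (letters v @ letters w)"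
instance by standard (simp_all add: zero_fword_def plus_fword_def)
end

type_synonym ('m, 'n) free_alg = "(('m + 'n) \<times> ('m + 'n)) fword \<Rightarrow>\<^sub>0 complex"

definition gen :: "'m + 'n \<Rightarrow> 'm + 'n \<Rightarrow> ('m, 'n) free_alg" where
  "gen a b = Poly_Mapping.single (FWord [(a, b)]) 1"

definition odd_unit :: "'m + 'n \<Rightarrow> 'm + 'n \<Rightarrow> bool" where
  "odd_unit a b \<longleftrightarrow> isl a \<noteq> isl b"

definition koszul_sign :: "'m + 'n \<Rightarrow> 'm + 'n \<Rightarrow> 'm + 'n \<Rightarrow> 'm + 'n \<Rightarrow> 'r::ring_1" where
  "koszul_sign a b c d = (if odd_unit a b \<and> odd_unit c d then - 1 else 1)"

text \<open>
  \<open>e\<^sub>a\<^sub>b e\<^sub>c\<^sub>d - (-1)\<^bsup>|ab||cd|\<^esup> e\<^sub>c\<^sub>d e\<^sub>a\<^sub>b - [e\<^sub>a\<^sub>b, e\<^sub>c\<^sub>d]\<close>, where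
  \<open>[e\<^sub>a\<^sub>b, e\<^sub>c\<^sub>d] = \<delta>\<^sub>b\<^sub>c e\<^sub>a\<^sub>d - (-1)\<^bsup>|ab||cd|\<^esup> \<delta>\<^sub>a\<^sub>d e\<^sub>c\<^sub>b\<close> is the superbracket of
  \<open>\<gg>\<ll>(m,n)\<close>.
\<close>

definition gl_relator :: "'m + 'n \<Rightarrow> 'm + 'n \<Rightarrow> 'm + 'n \<Rightarrow> 'm + 'n \<Rightarrow> ('m, 'n) free_alg" where
  "gl_relator a b c d =
     gen a b * gen c d - koszul_sign a b c d * (gen c d * gen a b)
     - ((if b = c then gen a d else 0) - koszul_sign a b c d * (if a = d then gen c b else 0))"

inductive_set gl_ideal :: "('m, 'n) free_alg set" where
  zero: "0 \<in> gl_ideal"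
| add: "x \<in> gl_ideal \<Longrightarrow> y \<in> gl_ideal \<Longrightarrow> x + y \<in> gl_ideal"
| rel: "u * gl_relator a b c d * v \<in> gl_ideal"

lemma gl_ideal_mult_left: "x \<in> gl_ideal \<Longrightarrow> w * x \<in> gl_ideal"
proof (induction rule: gl_ideal.induct)
  case (rel u a b c d v)
  then show ?case using gl_ideal.rel[of "w * u" a b c d v] by (simp add: mult.assoc)
qed (auto simp: algebra_simps intro: gl_ideal.intros)

lemma gl_ideal_mult_right: "x \<in> gl_ideal \<Longrightarrow> x * w \<in> gl_ideal"
proof (induction rule: gl_ideal.induct)
  case (rel u a b c d v)
  then show ?case using gl_ideal.rel[of u a b c d "v * w"] by (simp add: mult.assoc)
qed (auto simp: algebra_simps intro: gl_ideal.intros)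

lemma gl_ideal_uminus: "x \<in> gl_ideal \<Longrightarrow> - x \<in> gl_ideal"
  using gl_ideal_mult_left[of x "- 1"] by simp

lemma gl_ideal_diff: "x \<in> gl_ideal \<Longrightarrow> y \<in> gl_ideal \<Longrightarrow> x - y \<in> gl_ideal"
  using gl_ideal.add[of x "- y"] gl_ideal_uminus[of y] by simp

lemma poly_mapping_single_induct [case_names zero add]:
  fixes f :: "'k \<Rightarrow>\<^sub>0 'v::monoid_add"
  assumes zero: "P 0" and add: "\<And>k c f. P f \<Longrightarrow> P (Poly_Mapping.single k c + f)"
  shows "P f"
proof (induction f rule: update_induct)
  case const
  show ?case by (rule zero)
next
  case (update f k c)
  have "Poly_Mapping.update k c f = Poly_Mapping.single k c + f"
    using update by (intro poly_mapping_eqI) (auto simp: lookup_update lookup_add lookup_single when_def in_keys_iff)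
  with add[OF update(3)] show ?case by simp
qed

lemma lookup_mult_empty_word:
  fixes u v :: "'a fword \<Rightarrow>\<^sub>0 complex"
  shows "Poly_Mapping.lookup (u * v) 0 = Poly_Mapping.lookup u 0 * Poly_Mapping.lookup v 0"
proof -
  have single: "Poly_Mapping.lookup (Poly_Mapping.single k c * Poly_Mapping.single l d) 0
      = Poly_Mapping.lookup (Poly_Mapping.single k c) 0 * Poly_Mapping.lookup (Poly_Mapping.single l d) 0"
    for k l :: "'a fword" and c d :: complex
    by (cases k; cases l)
      (auto simp: mult_single lookup_single when_def zero_fword_def plus_fword_def)
  have "Poly_Mapping.lookup (Poly_Mapping.single k c * v) 0
      = Poly_Mapping.lookup (Poly_Mapping.single k c) 0 * Poly_Mapping.lookup v 0" for k c
    by (induction v rule: poly_mapping_single_induct) (simp_all add: single lookup_add algebra_simps)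
  then show ?thesis
    by (induction u rule: poly_mapping_single_induct) (simp_all add: lookup_add algebra_simps)
qed

lemma gl_ideal_proper: "1 \<notin> gl_ideal"
proof -
  have gen0: "Poly_Mapping.lookup (gen a b) 0 = 0" for a b :: "'m + 'n"
    by (simp add: gen_def lookup_single zero_fword_def)
  have "x \<in> gl_ideal \<Longrightarrow> Poly_Mapping.lookup x 0 = 0" for x :: "('m, 'n) free_alg"
    by (induction rule: gl_ideal.induct)
      (simp_all add: lookup_mult_empty_word lookup_add gl_relator_def lookup_minus gen0)
  from this[of 1] show ?thesis by (auto simp: lookup_one)
qed

quotient_type ('m, 'n) Ugl = "('m, 'n) free_alg" / "\<lambda>x y. x - y \<in> gl_ideal"
proof (rule equivpI)
  show "reflp (\<lambda>x y. x - y \<in> gl_ideal)"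
    by (rule reflpI) (simp add: gl_ideal.zero)
  show "symp (\<lambda>x y. x - y \<in> gl_ideal)"
    by (rule sympI) (use gl_ideal_uminus in fastforce)
  show "transp (\<lambda>x y. x - y \<in> gl_ideal)"
    by (rule transpI) (use gl_ideal.add in fastforce)
qed

instantiation Ugl :: (type, type) ring_1
begin

lift_definition zero_Ugl :: "('a, 'b) Ugl" is 0 .
lift_definition one_Ugl :: "('a, 'b) Ugl" is 1 .
lift_definition plus_Ugl :: "('a, 'b) Ugl \<Rightarrow> ('a, 'b) Ugl \<Rightarrow> ('a, 'b) Ugl" is "(+)"
  by (metis add_diff_add gl_ideal.add)
lift_definition uminus_Ugl :: "('a, 'b) Ugl \<Rightarrow> ('a, 'b) Ugl" is uminus
  by (metis gl_ideal_uminus minus_diff_minus)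
lift_definition minus_Ugl :: "('a, 'b) Ugl \<Rightarrow> ('a, 'b) Ugl \<Rightarrow> ('a, 'b) Ugl" is "(-)"
proof -
  fix x x' y y' :: "('a, 'b) free_alg"
  assume "x - x' \<in> gl_ideal" "y - y' \<in> gl_ideal"
  then have "(x - x') - (y - y') \<in> gl_ideal" by (rule gl_ideal_diff)
  then show "(x - y) - (x' - y') \<in> gl_ideal" by (simp add: algebra_simps)
qed
lift_definition times_Ugl :: "('a, 'b) Ugl \<Rightarrow> ('a, 'b) Ugl \<Rightarrow> ('a, 'b) Ugl" is "(*)"
proof -
  fix x x' y y' :: "('a, 'b) free_alg"
  assume "x - x' \<in> gl_ideal" "y - y' \<in> gl_ideal"
  then have "(x - x') * y + x' * (y - y') \<in> gl_ideal"
    by (intro gl_ideal.add gl_ideal_mult_left gl_ideal_mult_right)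
  then show "x * y - x' * y' \<in> gl_ideal" by (simp add: algebra_simps)
qed

instance
proof
  show "(0 :: ('a, 'b) Ugl) \<noteq> 1"
    by transfer (use gl_ideal_proper gl_ideal_uminus in fastforce)
qed (transfer; simp add: algebra_simps gl_ideal.zero)+

end

text \<open>The structure map \<open>\<complex> \<rightarrow> U(\<gg>)\<close> and the matrix units in \<open>U(\<gg>)\<close>.\<close>

lift_definition cst :: "complex \<Rightarrow> ('m, 'n) Ugl" is "Poly_Mapping.single 0" .

lift_definition eU :: "'m + 'n \<Rightarrow> 'm + 'n \<Rightarrow> ('m, 'n) Ugl" is gen .

lemma eU_superbracket:
  "eU a b * eU c d - koszul_sign a b c d * (eU c d * eU a b) =
     (if b = c then eU a d else 0) - koszul_sign a b c d * (if a = d then eU c b else 0)"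
proof -
  have "gl_relator a b c d \<in> gl_ideal"
    using gl_ideal.rel[of 1 a b c d 1] by simp
  then have rel: "abs_Ugl (gl_relator a b c d) = 0"
    by (simp add: zero_Ugl_def Ugl.abs_eq_iff)
  have sign: "abs_Ugl (koszul_sign a b c d) = koszul_sign a b c d"
    by (simp add: koszul_sign_def one_Ugl_def uminus_Ugl.abs_eq)
  have delta: "abs_Ugl (if P then gen x y else 0) = (if P then eU x y else 0)" for P x y
    by (simp add: eU.abs_eq zero_Ugl_def)
  show ?thesis
    using rel unfolding gl_relator_def
    by (simp only: minus_Ugl.abs_eq[symmetric] times_Ugl.abs_eq[symmetric] sign delta
        eU.abs_eq[symmetric] right_minus_eq)
qed

lemma cst_add: "cst (x + y) = cst x + cst y"
  by transfer (simp add: single_add gl_ideal.zero)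

lemma cst_mult: "cst (x * y) = cst x * cst y"
  by transfer (simp add: mult_single gl_ideal.zero)

lemma cst_1: "cst 1 = 1"
  by transfer (simp add: gl_ideal.zero)

lemma cst_central: "cst c * u = u * cst c"
proof transfer
  fix c :: complex and u :: "('a, 'b) free_alg"
  have "Poly_Mapping.single 0 c * u = u * Poly_Mapping.single 0 c"
    by (induction u rule: poly_mapping_single_induct) (simp_all add: mult_single algebra_simps)
  then show "Poly_Mapping.single 0 c * u - u * Poly_Mapping.single 0 c \<in> gl_ideal"
    by (simp add: gl_ideal.zero)
qed

inductive_set subalg :: "('m, 'n) Ugl set \<Rightarrow> ('m, 'n) Ugl set" for S where
  cst: "cst c \<in> subalg S"
| base: "s \<in> S \<Longrightarrow> s \<in> subalg S"
| add: "u \<in> subalg S \<Longrightarrow> v \<in> subalg S \<Longrightarrow> u + v \<in> subalg S"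
| mult: "u \<in> subalg S \<Longrightarrow> v \<in> subalg S \<Longrightarrow> u * v \<in> subalg S"

inductive_set left_ideal :: "('m, 'n) Ugl set \<Rightarrow> ('m, 'n) Ugl set" for S where
  zero: "0 \<in> left_ideal S"
| add: "s \<in> S \<Longrightarrow> v \<in> left_ideal S \<Longrightarrow> u * s + v \<in> left_ideal S"

section \<open>Weights and roots\<close>

text \<open>
  An element of \<open>\<hh>\<^sup>*\<close> is given by its coordinates in the basis \<open>\<epsilon>\<^sub>i, \<delta>\<^sub>j\<close>, an element of \<open>\<hh>\<close>
  by its diagonal entries.
\<close>

type_synonym ('m, 'n) weight = "complex ^ ('m + 'n)"
type_synonym ('m, 'n) cartan = "complex ^ ('m + 'n)"

definition chi :: "'m::finite + 'n::finite \<Rightarrow> ('m, 'n) weight" where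
  "chi a = axis a 1"

definition pairing :: "('m::finite, 'n::finite) weight \<Rightarrow> ('m, 'n) cartan \<Rightarrow> complex" where
  "pairing \<beta> h = (\<Sum>a\<in>UNIV. \<beta> $ a * h $ a)"

definition form :: "('m::finite, 'n::finite) weight \<Rightarrow> ('m, 'n) weight \<Rightarrow> complex" where
  "form \<alpha> \<beta> = (\<Sum>a\<in>UNIV. (if isl a then 1 else - 1) * \<alpha> $ a * \<beta> $ a)"

definition hvec :: "('m::finite, 'n::finite) weight \<Rightarrow> ('m, 'n) cartan" where
  "hvec \<alpha> = (THE h. \<forall>\<beta>. pairing \<beta> h = form \<alpha> \<beta>)"

lemma pairing_chi: "pairing (chi a) h = h $ a"
  unfolding pairing_def chi_def axis_def by (simp add: if_distrib[of "\<lambda>x. x * _"] cong: if_cong)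

lemma hvec_eq: "hvec \<alpha> = (\<chi> a. (if isl a then 1 else - 1) * \<alpha> $ a)"
  unfolding hvec_def
proof (rule the_equality)
  show *: "\<forall>\<beta>. pairing \<beta> (\<chi> a. (if isl a then 1 else - 1) * \<alpha> $ a) = form \<alpha> \<beta>"
    by (auto simp: pairing_def form_def mult_ac intro!: sum.cong)
  fix h assume "\<forall>\<beta>. pairing \<beta> h = form \<alpha> \<beta>"
  with * show "h = (\<chi> a. (if isl a then 1 else - 1) * \<alpha> $ a)"
    by (metis (no_types, lifting) pairing_chi vec_eq_iff)
qed

lemma pairing_hvec: "pairing \<beta> (hvec \<alpha>) = form \<alpha> \<beta>"
  unfolding hvec_eq by (auto simp: pairing_def form_def mult_ac intro!: sum.cong)

definition hU :: "('m::finite, 'n::finite) cartan \<Rightarrow> ('m, 'n) Ugl" where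
  "hU h = (\<Sum>a\<in>UNIV. cst (h $ a) * eU a a)"

definition even_roots :: "('m::finite, 'n::finite) weight set" where
  "even_roots = {chi a - chi b | a b. a \<noteq> b \<and> \<not> odd_unit a b}"

definition odd_roots :: "('m::finite, 'n::finite) weight set" where
  "odd_roots = {chi a - chi b | a b. odd_unit a b}"

definition gl_m_roots :: "('m::finite, 'n::finite) weight set" where
  "gl_m_roots = {chi (Inl i) - chi (Inl j) | i j. i \<noteq> j}"

definition gl_n_roots :: "('m::finite, 'n::finite) weight set" where
  "gl_n_roots = {chi (Inr i) - chi (Inr j) | i j. i \<noteq> j}"

definition root_vec :: "('m::finite, 'n::finite) weight \<Rightarrow> ('m, 'n) Ugl" where
  "root_vec \<alpha> = (THE u. \<exists>a b. a \<noteq> b \<and> \<alpha> = chi a - chi b \<and> u = eU a b)"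

lemma chi_diff_inject:
  assumes "a \<noteq> b" "chi a - chi b = chi c - chi d"
  shows "a = c \<and> b = d"
proof -
  have *: "(if i = a then 1 else 0) - (if i = b then 1 else 0)
      = (if i = c then 1 else 0) - (if i = d then 1 else (0::complex))" for i
    using arg_cong[OF assms(2), of "\<lambda>v. v $ i"] by (simp add: chi_def axis_def)
  show ?thesis using *[of a] *[of b] assms(1) by (auto split: if_splits)
qed

lemma root_vec_eq: "a \<noteq> b \<Longrightarrow> root_vec (chi a - chi b) = eU a b"
  unfolding root_vec_def by (rule the_equality) (auto dest: chi_diff_inject)

section \<open>Borel subalgebras given by shuffles\<close>

text \<open>
  Throughout, \<open>xs\<close> is the ordering \<open>(x\<^sub>1, \<dots>, x\<^bsub>m+n\<^esub>)\<close>; positions are counted from \<open>1\<close>.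
\<close>

definition shuffle :: "('m::{finite,linorder} + 'n::{finite,linorder}) list \<Rightarrow> bool" where
  "shuffle xs \<longleftrightarrow>
     xs \<in> shuffles (map Inl (sorted_list_of_set UNIV)) (map Inr (sorted_list_of_set UNIV))"

definition elt :: "('m + 'n) list \<Rightarrow> nat \<Rightarrow> 'm + 'n" where
  "elt xs p = xs ! (p - 1)"

definition pos_roots :: "('m::finite + 'n::finite) list \<Rightarrow> ('m, 'n) weight set" where
  "pos_roots xs = {chi (elt xs p) - chi (elt xs q) | p q. 1 \<le> p \<and> p < q \<and> q \<le> length xs}"

definition simple_root :: "('m::finite + 'n::finite) list \<Rightarrow> nat \<Rightarrow> ('m, 'n) weight" where
  "simple_root xs k = chi (elt xs k) - chi (elt xs (k + 1))"

definition simple_roots :: "('m::finite + 'n::finite) list \<Rightarrow> ('m, 'n) weight set" where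
  "simple_roots xs = simple_root xs ` {1..length xs - 1}"

definition n_plus_basis :: "('m + 'n) list \<Rightarrow> ('m, 'n) Ugl set" where
  "n_plus_basis xs = {eU (elt xs p) (elt xs q) | p q. 1 \<le> p \<and> p < q \<and> q \<le> length xs}"

definition n_minus_basis :: "('m + 'n) list \<Rightarrow> ('m, 'n) Ugl set" where
  "n_minus_basis xs = {eU (elt xs p) (elt xs q) | p q. 1 \<le> q \<and> q < p \<and> p \<le> length xs}"

definition U_h :: "('m, 'n) Ugl set" where
  "U_h = subalg {eU a a | a. True}"

definition U_b_minus :: "('m + 'n) list \<Rightarrow> ('m, 'n) Ugl set" where
  "U_b_minus xs = subalg ({eU a a | a. True} \<union> n_minus_basis xs)"

definition rho :: "('m::finite + 'n::finite) list \<Rightarrow> ('m, 'n) weight" where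
  "rho xs = (1 / 2) *s (\<Sum>\<alpha>\<in>pos_roots xs \<inter> even_roots. \<alpha>)
          - (1 / 2) *s (\<Sum>\<alpha>\<in>pos_roots xs \<inter> odd_roots. \<alpha>)"

section \<open>Sapovalov elements\<close>

definition partitions :: "('m::finite + 'n::finite) list \<Rightarrow> ('m, 'n) weight
    \<Rightarrow> (('m, 'n) weight \<Rightarrow> nat) set" where
  "partitions xs \<eta> = {\<pi>. (\<forall>\<alpha>. \<alpha> \<notin> pos_roots xs \<longrightarrow> \<pi> \<alpha> = 0)
     \<and> (\<forall>\<alpha>\<in>pos_roots xs \<inter> odd_roots. \<pi> \<alpha> \<le> 1)
     \<and> (\<Sum>\<alpha>\<in>pos_roots xs. of_nat (\<pi> \<alpha>) *s \<alpha>) = \<eta>}"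

text \<open>An order on the positive roots is given by the list \<open>rs\<close> of all positive roots.\<close>

definition root_order :: "('m::finite + 'n::finite) list \<Rightarrow> ('m, 'n) weight list \<Rightarrow> bool" where
  "root_order xs rs \<longleftrightarrow> distinct rs \<and> set rs = pos_roots xs"

definition e_minus :: "('m::finite, 'n::finite) weight list
    \<Rightarrow> (('m, 'n) weight \<Rightarrow> nat) \<Rightarrow> ('m, 'n) Ugl" where
  "e_minus rs \<pi> = prod_list (map (\<lambda>\<alpha>. root_vec (- \<alpha>) ^ \<pi> \<alpha>) rs)"

text \<open>
  Sapovalov elements for \<open>(\<eta>, 1)\<close>. The element \<open>h\<^sub>\<eta> + \<rho>(h\<^sub>\<eta>)\<close> is the one for isotropic \<open>\<eta>\<close>;
  in general there would be a further term \<open>- (\<eta>, \<eta>) / 2\<close>.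
\<close>

definition sapovalov :: "('m::finite + 'n::finite) list \<Rightarrow> ('m, 'n) weight list
    \<Rightarrow> ('m, 'n) weight \<Rightarrow> ('m, 'n) Ugl \<Rightarrow> bool" where
  "sapovalov xs rs \<eta> \<theta> \<longleftrightarrow>
     \<theta> \<in> U_b_minus xs
     \<and> (\<forall>h. hU h * \<theta> - \<theta> * hU h = cst (- pairing \<eta> h) * \<theta>)
     \<and> (\<exists>H. (\<forall>\<pi>\<in>partitions xs \<eta>. H \<pi> \<in> U_h)
          \<and> (\<forall>\<pi>\<in>partitions xs \<eta>. (\<forall>\<alpha>. \<alpha> \<notin> simple_roots xs \<longrightarrow> \<pi> \<alpha> = 0) \<longrightarrow> H \<pi> = 1)
          \<and> \<theta> = (\<Sum>\<pi>\<in>partitions xs \<eta>. e_minus rs \<pi> * H \<pi>))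
     \<and> (\<forall>\<alpha>\<in>pos_roots xs. \<exists>u. \<exists>v\<in>left_ideal (n_plus_basis xs).
          root_vec \<alpha> * \<theta> = u * (hU (hvec \<eta>) + cst (pairing (rho xs) (hvec \<eta>))) + v)"

section \<open>The element \<open>\<Theta>\<^sub>\<eta>\<close>\<close>

definition first_index :: "'m::{finite,linorder} + 'n" where
  "first_index = Inl (Min UNIV)"

definition last_index :: "'m + 'n::{finite,linorder}" where
  "last_index = Inr (Max UNIV)"

definition eta :: "('m::{finite,linorder}, 'n::{finite,linorder}) weight" where
  "eta = chi first_index - chi last_index"

definition num_odd :: "('m::finite + 'n::finite) list \<Rightarrow> nat \<Rightarrow> nat" where
  "num_odd xs k = card {j. 1 \<le> j \<and> j < k \<and> simple_root xs j \<in> odd_roots}"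

definition s_elt :: "('m::finite + 'n::finite) list \<Rightarrow> nat \<Rightarrow> ('m, 'n) cartan" where
  "s_elt xs k = (\<Sum>j = 1..k. hvec (simple_root xs j))"

definition ell :: "('m::finite + 'n::finite) list \<Rightarrow> nat \<Rightarrow> int" where
  "ell xs k = int (card {i \<in> {1..<k}. simple_root xs i \<in> gl_n_roots})
            - int (card {i \<in> {1..<k}. simple_root xs i \<in> gl_m_roots})"

definition ibar :: "('m::finite + 'n::finite) list \<Rightarrow> nat \<Rightarrow> complex" where
  "ibar xs k = (1 - (- 1) ^ num_odd xs k) / 2"

definition d_shift :: "('m::finite + 'n::finite) list \<Rightarrow> nat \<Rightarrow> complex" where
  "d_shift xs k = of_int (ell xs k) + ibar xs k"

text \<open>\<open>t_elt xs j\<close> is \<open>t\<^sub>e\<close> for \<open>e = x\<^bsub>j+1\<^esub>\<close>.\<close>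

definition t_elt :: "('m::finite + 'n::finite) list \<Rightarrow> nat \<Rightarrow> ('m, 'n) Ugl" where
  "t_elt xs j = (- 1) ^ num_odd xs (j + 1) * (hU (s_elt xs j) - cst (d_shift xs j))"

definition index_sets :: "('m::{finite,linorder} + 'n::{finite,linorder}) set set" where
  "index_sets = {I. first_index \<in> I \<and> last_index \<in> I}"

text \<open>
  The list \<open>x\<^bsub>p\<^sub>0\<^esub>, x\<^bsub>p\<^sub>1\<^esub>, \<dots>\<close> of the elements of \<open>I\<close> by descending position; \<open>f_elt\<close> is the product
  of the \<open>eU a b\<close> over pairs of successive members \<open>a, b\<close>, and \<open>chain_roots\<close> lists the
  positive roots \<open>\<alpha>\<close> with \<open>eU a b = e\<^sub>-\<^sub>\<alpha>\<close> in the same order.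
\<close>

definition chain :: "('m + 'n) list \<Rightarrow> ('m + 'n) set \<Rightarrow> ('m + 'n) list" where
  "chain xs I = filter (\<lambda>a. a \<in> I) (rev xs)"

definition f_elt :: "('m + 'n) list \<Rightarrow> ('m + 'n) set \<Rightarrow> ('m, 'n) Ugl" where
  "f_elt xs I = prod_list (map2 eU (chain xs I) (tl (chain xs I)))"

definition chain_roots :: "('m::finite + 'n::finite) list \<Rightarrow> ('m + 'n) set \<Rightarrow> ('m, 'n) weight list" where
  "chain_roots xs I = map2 (\<lambda>a b. chi b - chi a) (chain xs I) (tl (chain xs I))"

text \<open>
  The factors \<open>t\<^sub>e\<close> commute; the product is written as an ordered one only because the type of
  \<open>U(\<gg>)\<close> is not commutative. The indices outside \<open>I\<close> are neither \<open>x\<^sub>1 = 1\<close> nor \<open>x\<^bsub>m+n\<^esub> = n'\<close>,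
  so they are \<open>x\<^bsub>j+1\<^esub>\<close> with \<open>1 \<le> j \<le> m+n-2\<close>.
\<close>

definition H_elt :: "('m::finite + 'n::finite) list \<Rightarrow> ('m + 'n) set \<Rightarrow> ('m, 'n) Ugl" where
  "H_elt xs I = prod_list (map (t_elt xs) (filter (\<lambda>j. elt xs (j + 1) \<notin> I) [1..<length xs - 1]))"

definition Theta :: "('m::{finite,linorder} + 'n::{finite,linorder}) list \<Rightarrow> ('m, 'n) Ugl" where
  "Theta xs = (\<Sum>J\<in>index_sets. f_elt xs J * H_elt xs J)"

text \<open>
  The orders on \<open>\<Delta>\<^sup>+\<close> for which every \<open>f\<^sub>J\<close> is an ordered monomial \<open>e\<^sub>-\<^sub>\<pi>\<close>: the factors of \<open>f\<^sub>J\<close> occur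
  in increasing order. Such orders exist (\<open>f_compatible_order_exists\<close>).
\<close>

definition f_compatible :: "('m::{finite,linorder} + 'n::{finite,linorder}) list
    \<Rightarrow> ('m, 'n) weight list \<Rightarrow> bool" where
  "f_compatible xs rs \<longleftrightarrow> (\<forall>J\<in>index_sets. subseq (chain_roots xs J) rs)"

fun desc_roots :: "('m::finite + 'n::finite) list \<Rightarrow> ('m, 'n) weight list" where
  "desc_roots [] = []"
| "desc_roots (y # ys) = map (\<lambda>b. chi b - chi y) ys @ desc_roots ys"

lemma subseq_desc_roots:
  "subseq (map2 (\<lambda>a b. chi b - chi a) (filter P ys) (tl (filter P ys))) (desc_roots ys)"
proof (induction ys)
  case (Cons y ys)
  show ?case
  proof (cases "P y \<and> filter P ys \<noteq> []")
    case True
    then obtain b F where F: "filter P ys = b # F" by (cases "filter P ys") auto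
    then have "b \<in> set ys" by (metis filter_is_subset list.set_intros(1) subsetD)
    then have "subseq [chi b - chi y] (map (\<lambda>b. chi b - chi y) ys)"
      by (simp add: subseq_singleton_left)
    from list_emb_append_mono[OF this Cons.IH] show ?thesis
      using True F by simp
  next
    case False
    then show ?thesis using Cons.IH by (auto intro: list_emb_append2)
  qed
qed simp

lemma set_desc_roots:
  "set (desc_roots ys) = {chi (ys ! j) - chi (ys ! i) | i j. i < j \<and> j < length ys}"
proof (induction ys)
  case (Cons y ys)
  show ?case (is "_ = ?R")
  proof (intro equalityI subsetI)
    fix x assume "x \<in> set (desc_roots (y # ys))"
    then consider j where "j < length ys" "x = chi (ys ! j) - chi y"
      | i j where "i < j" "j < length ys" "x = chi (ys ! j) - chi (ys ! i)"
      using Cons.IH by (auto simp: in_set_conv_nth)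
    then show "x \<in> ?R"
    proof cases
      case 1
      then show ?thesis by (intro CollectI exI[of _ 0] exI[of _ "Suc j"]) auto
    next
      case 2
      then show ?thesis by (intro CollectI exI[of _ "Suc i"] exI[of _ "Suc j"]) auto
    qed
  next
    fix x assume "x \<in> ?R"
    then obtain i j where ij: "i < j" "j < length (y # ys)"
      "x = chi ((y # ys) ! j) - chi ((y # ys) ! i)" by blast
    then obtain j' where j: "j = Suc j'" by (cases j) auto
    show "x \<in> set (desc_roots (y # ys))"
    proof (cases i)
      case 0
      then show ?thesis using ij j by auto
    next
      case (Suc i')
      then show ?thesis using ij j Cons.IH by auto
    qed
  qed
qed simp

lemma distinct_desc_roots: "distinct ys \<Longrightarrow> distinct (desc_roots ys)"
proof (induction ys)
  case (Cons y ys)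
  have "chi b - chi y \<notin> set (desc_roots ys)" if "b \<in> set ys" for b
  proof
    assume "chi b - chi y \<in> set (desc_roots ys)"
    then obtain i j where "i < j" "j < length ys" "chi b - chi y = chi (ys ! j) - chi (ys ! i)"
      by (auto simp: set_desc_roots)
    moreover have "b \<noteq> y" using that Cons.prems by auto
    ultimately have "y = ys ! i" "i < length ys"
      using chi_diff_inject[of b y "ys ! j" "ys ! i"] by auto
    then show False using Cons.prems by auto
  qed
  moreover have "inj_on (\<lambda>b. chi b - chi y) (set ys)"
    by (rule inj_onI) (simp add: chi_def axis_eq_axis)
  ultimately show ?case using Cons by (auto simp: distinct_map)
qed simp

lemma f_compatible_order_exists:
  assumes "shuffle xs"
  shows "\<exists>rs. root_order xs rs \<and> f_compatible xs rs"
proof (intro exI conjI)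
  have "distinct xs"
    using assms unfolding shuffle_def
    by (rule distinct_disjoint_shuffles[rotated 3]) (auto simp: distinct_map)
  moreover have "set (desc_roots (rev xs)) = pos_roots xs"
  proof (intro equalityI subsetI)
    fix x assume "x \<in> set (desc_roots (rev xs))"
    then obtain i j where "i < j" "j < length xs" "x = chi (rev xs ! j) - chi (rev xs ! i)"
      by (auto simp: set_desc_roots)
    then show "x \<in> pos_roots xs"
      unfolding pos_roots_def elt_def
      by (intro CollectI exI[of _ "length xs - j"] exI[of _ "length xs - i"])
        (auto simp: rev_nth)
  next
    fix x assume "x \<in> pos_roots xs"
    then obtain p q where "1 \<le> p" "p < q" "q \<le> length xs"
      "x = chi (xs ! (p - 1)) - chi (xs ! (q - 1))"
      by (auto simp: pos_roots_def elt_def)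
    then show "x \<in> set (desc_roots (rev xs))"
      unfolding set_desc_roots
      by (intro CollectI exI[of _ "length xs - q"] exI[of _ "length xs - p"])
        (auto simp: rev_nth)
  qed
  ultimately show "root_order xs (desc_roots (rev xs))"
    by (simp add: root_order_def distinct_desc_roots)
  show "f_compatible xs (desc_roots (rev xs))"
    unfolding f_compatible_def chain_roots_def chain_def by (blast intro: subseq_desc_roots)
qed

end

theory Submission
  imports Defs
begin

text \<open>
  Write \<open>E\<^sub>p\<^sub>q\<close> for the matrix unit at \<open>(x\<^sub>p, x\<^sub>q)\<close>, \<open>\<sigma>\<^sub>p = \<plusminus>1\<close> for the parity sign of \<open>x\<^sub>p\<close>, \<open>S\<^sub>p\<close> for
  \<open>\<sigma>\<^sub>1 + \<dots> + \<sigma>\<^sub>p\<close> and \<open>t\<^sub>p\<close> for \<open>t\<^sub>e\<close> with \<open>e = x\<^sub>p\<close>. Then \<open>d\<^sub>j = 1 - S\<^sub>j\<close>, so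
  \<open>t\<^sub>p = \<sigma>\<^sub>p (E\<^sub>1\<^sub>1 + S\<^bsub>p-1\<^esub> - 1) - E\<^sub>p\<^sub>p\<close>. Splitting chains at their second element,
  \<open>\<Theta>\<close> is the last of the elements \<open>\<Theta>\<^sub>1 = 1\<close>, \<open>\<Theta>\<^sub>p = \<Sum>\<^bsub>q<p\<^esub> E\<^sub>p\<^sub>q \<Theta>\<^sub>q t\<^bsub>q+1\<^esub> \<cdots> t\<^bsub>p-1\<^esub>\<close>. By induction on \<open>p\<close>,
  modulo \<open>U(\<gg>)\<nn>\<^sup>+\<close> the simple root vector \<open>E\<^bsub>k,k+1\<^esub>\<close> kills \<open>\<Theta>\<^sub>p\<close> unless \<open>p = k + 1\<close>, and
  \<open>E\<^bsub>p-1,p\<^esub> \<Theta>\<^sub>p\<close> is congruent to \<open>\<sigma>\<^bsub>p-1\<^esub> \<sigma>\<^sub>p \<Theta>\<^bsub>p-1\<^esub> t\<^sub>p\<close>: the commutator terms telescope because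
  \<open>t\<^bsub>p-1\<^esub> + E\<^bsub>p-1,p-1\<^esub> + 1 - \<sigma>\<^bsub>p-1\<^esub> \<sigma>\<^sub>p E\<^sub>p\<^sub>p = \<sigma>\<^bsub>p-1\<^esub> \<sigma>\<^sub>p t\<^sub>p\<close>. For the last index,
  the same formula for \<open>t\<^sub>p\<close> gives \<open>- (h\<^sub>\<eta> + \<rho>(h\<^sub>\<eta>))\<close>.
\<close>

subsection \<open>Commutators and left ideals\<close>

definition sg :: "'m + 'n \<Rightarrow> complex" where
  "sg a = (if isl a then 1 else - 1)"

lemma sg_mult_self [simp]: "sg a * sg a = 1"
  by (simp add: sg_def)

lemma cst_0 [simp]: "cst 0 = 0"
  using cst_add[of 0 0] by simp

lemma cst_minus: "cst (- x) = - cst x"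
  using cst_add[of x "- x"] by (simp add: eq_neg_iff_add_eq_0 add.commute)

lemma cst_diff: "cst (x - y) = cst x - cst y"
  using cst_add[of x "- y"] by (simp add: cst_minus)

lemma cst_power: "cst (x ^ k) = cst x ^ k"
  by (induction k) (simp_all add: cst_1 cst_mult)

lemma cst_sum: "cst (sum f A) = (\<Sum>a\<in>A. cst (f a))"
  by (induction A rule: infinite_finite_induct) (simp_all add: cst_add)

lemma cst_left_commute: "u * (cst c * v) = cst c * (u * v)"
  by (metis cst_central mult.assoc)

text \<open>The sign is polymorphic in its ring; as the image of a complex number it is a central
  scalar and can be moved through products.\<close>

lemma koszul_sign_eq_cst: "koszul_sign a b c d = cst (koszul_sign a b c d)"
  by (simp add: koszul_sign_def cst_1 cst_minus)

lemma koszul_sign_swap: "koszul_sign a b b a = sg a * sg b"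
  by (cases a; cases b) (simp_all add: koszul_sign_def odd_unit_def sg_def)

text \<open>The parity of \<open>e_ca\<close> is the sum of those of \<open>e_cb\<close> and
  \<open>e_ab\<close>. This matches the signs of two terms that cancel in
  \<open>E_simple_partial_Theta\<close>.\<close>

lemma koszul_sign_shift: "koszul_sign a b c b * (sg a * sg b) = koszul_sign a b c a"
  by (cases a; cases b; cases c) (simp_all add: koszul_sign_def odd_unit_def sg_def)

lemma eU_commute:
  "eU a b * eU c d = cst (koszul_sign a b c d) * (eU c d * eU a b)
     + (if b = c then eU a d else 0) - cst (koszul_sign a b c d) * (if a = d then eU c b else 0)"
  using eU_superbracket[of a b c d] unfolding koszul_sign_eq_cst[symmetric]
  by (simp add: algebra_simps)

lemma eU_diag_commute:
  "eU c c * eU a b = eU a b * eU c c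
     + cst ((if c = a then 1 else 0) - (if c = b then 1 else 0)) * eU a b"
  using eU_superbracket[of c c a b]
  by (auto simp: koszul_sign_def odd_unit_def cst_1 cst_minus algebra_simps)

lemma left_ideal_base: "s \<in> S \<Longrightarrow> u * s \<in> left_ideal S"
  using left_ideal.add[of s S 0 u] by (simp add: left_ideal.zero)

lemma left_ideal_add: "x \<in> left_ideal S \<Longrightarrow> y \<in> left_ideal S \<Longrightarrow> x + y \<in> left_ideal S"
  by (induction rule: left_ideal.induct) (simp_all add: add.assoc left_ideal.add)

lemma left_ideal_mult_left: "x \<in> left_ideal S \<Longrightarrow> w * x \<in> left_ideal S"
proof (induction rule: left_ideal.induct)
  case (add s v u)
  then show ?case using left_ideal.add[of s S "w * v" "w * u"] by (simp add: algebra_simps)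
qed (simp add: left_ideal.zero)

lemma left_ideal_uminus: "x \<in> left_ideal S \<Longrightarrow> - x \<in> left_ideal S"
  using left_ideal_mult_left[of x S "- 1"] by simp

lemma left_ideal_diff: "x \<in> left_ideal S \<Longrightarrow> y \<in> left_ideal S \<Longrightarrow> x - y \<in> left_ideal S"
  using left_ideal_add[of x S "- y"] left_ideal_uminus[of y S] by simp

lemma left_ideal_sum: "(\<And>a. a \<in> A \<Longrightarrow> f a \<in> left_ideal S) \<Longrightarrow> sum f A \<in> left_ideal S"
  by (induction A rule: infinite_finite_induct) (auto intro: left_ideal.zero left_ideal_add)

text \<open>Each generator e of the ideal is a weight vector, so e s = (s - r) e with a scalar r for
  every diagonal unit s. This absorbs the factors t, which stand to the right of the partial
  sums.\<close>

lemma left_ideal_U_h_mult_right: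
  assumes "h \<in> U_h" "x \<in> left_ideal (n_plus_basis xs)"
  shows "x * h \<in> left_ideal (n_plus_basis xs)"
  using assms unfolding U_h_def
proof (induction arbitrary: x rule: subalg.induct)
  case (cst c)
  then show ?case by (metis cst_central left_ideal_mult_left)
next
  case (base s)
  then obtain c where s: "s = eU c c" by auto
  from base.prems show ?case
  proof (induction rule: left_ideal.induct)
    case zero
    then show ?case by (simp add: left_ideal.zero)
  next
    case (add e v u)
    then obtain a b where e: "e = eU a b" by (auto simp: n_plus_basis_def)
    define r :: complex where "r = (if c = a then 1 else 0) - (if c = b then 1 else 0)"
    have "e * s = s * e - cst r * e"
      unfolding e s r_def by (simp add: eU_diag_commute)
    then have "(u * e + v) * s = u * (s - cst r) * e + v * s"
      by (simp add: distrib_right left_diff_distrib right_diff_distrib mult.assoc)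
    with add show ?case by (simp add: left_ideal.add)
  qed
next
  case (add u v)
  then show ?case by (simp add: distrib_left left_ideal_add)
next
  case (mult u v)
  then show ?case by (simp add: mult.assoc[symmetric])
qed

section \<open>The subalgebra U(h) and the elements t_e in it\<close>

lemma cst_in_U_h: "cst c \<in> U_h"
  unfolding U_h_def by (rule subalg.cst)

lemma U_h_mult: "u \<in> U_h \<Longrightarrow> v \<in> U_h \<Longrightarrow> u * v \<in> U_h"
  unfolding U_h_def by (rule subalg.mult)

lemma U_h_add: "u \<in> U_h \<Longrightarrow> v \<in> U_h \<Longrightarrow> u + v \<in> U_h"
  unfolding U_h_def by (rule subalg.add)

lemma U_h_diff: "u \<in> U_h \<Longrightarrow> v \<in> U_h \<Longrightarrow> u - v \<in> U_h"
  using U_h_add[of u "cst (- 1) * v"] U_h_mult[OF cst_in_U_h, of v "- 1"]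
  by (simp add: cst_minus cst_1)

lemma subalg_sum: "(\<And>a. a \<in> A \<Longrightarrow> f a \<in> subalg S) \<Longrightarrow> sum f A \<in> subalg S"
  by (induction A rule: infinite_finite_induct)
    (auto intro: subalg.add subalg.cst[of 0, simplified])

lemma subalg_prod_list: "(\<And>u. u \<in> set us \<Longrightarrow> u \<in> subalg S) \<Longrightarrow> prod_list us \<in> subalg S"
  by (induction us) (auto intro: subalg.mult subalg.cst[of 1, simplified cst_1])

lemma subalg_mono: "S \<subseteq> S' \<Longrightarrow> subalg S \<subseteq> subalg S'"
proof
  fix u assume "S \<subseteq> S'" "u \<in> subalg S"
  from this(2,1) show "u \<in> subalg S'"
    by induction (auto intro: subalg.intros)
qed

lemma U_h_subset_U_b_minus: "U_h \<subseteq> U_b_minus xs"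
  unfolding U_h_def U_b_minus_def by (rule subalg_mono) blast

lemma hU_in_U_h: "hU h \<in> U_h"
  unfolding hU_def U_h_def
  by (intro subalg_sum subalg.mult subalg.cst subalg.base) auto

lemma t_elt_in_U_h: "t_elt xs j \<in> U_h"
proof -
  have "t_elt xs j = cst ((- 1) ^ num_odd xs (j + 1)) * (hU (s_elt xs j) - cst (d_shift xs j))"
    by (simp add: t_elt_def cst_power cst_minus cst_1)
  then show ?thesis by (simp add: U_h_mult U_h_diff cst_in_U_h hU_in_U_h)
qed

lemma prod_list_t_elt_in_U_h: "prod_list (map (t_elt xs) js) \<in> U_h"
  unfolding U_h_def by (rule subalg_prod_list) (use t_elt_in_U_h[unfolded U_h_def] in auto)

subsection \<open>Weights\<close>

text \<open>The function w is the coordinate vector of the weight: \<open>w c\<close> is the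
  eigenvalue of ad \<open>eU c c\<close> on u.\<close>

definition has_weight :: "('m + 'n \<Rightarrow> complex) \<Rightarrow> ('m, 'n) Ugl \<Rightarrow> bool" where
  "has_weight w u \<longleftrightarrow> (\<forall>c. eU c c * u = u * eU c c + cst (w c) * u)"

lemma has_weight_mult:
  assumes "has_weight w u" "has_weight w' u'"
  shows "has_weight (\<lambda>c. w c + w' c) (u * u')"
  unfolding has_weight_def
proof
  fix c
  have "eU c c * (u * u') = u * (eU c c * u') + cst (w c) * u * u'"
    using assms(1) by (simp add: has_weight_def mult.assoc[symmetric] distrib_right)
  also have "\<dots> = u * (u' * eU c c) + u * cst (w' c) * u' + cst (w c) * u * u'"
    using assms(2) by (simp add: has_weight_def mult.assoc distrib_left)
  finally show "eU c c * (u * u') = u * u' * eU c c + cst (w c + w' c) * (u * u')"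
    by (simp add: cst_add distrib_left distrib_right mult.assoc cst_left_commute[of u] add_ac)
qed

lemma has_weight_sum:
  "(\<And>a. a \<in> A \<Longrightarrow> has_weight w (f a)) \<Longrightarrow> has_weight w (sum f A)"
  by (auto simp: has_weight_def sum_distrib_left sum_distrib_right sum.distrib)

lemma has_weight_eU:
  "has_weight (\<lambda>c. (if c = a then 1 else 0) - (if c = b then 1 else 0)) (eU a b)"
  unfolding has_weight_def using eU_diag_commute by blast

lemma has_weight_U_h:
  assumes "h \<in> U_h"
  shows "has_weight (\<lambda>_. 0) h"
  using assms unfolding U_h_def
proof (induction rule: subalg.induct)
  case (cst c)
  then show ?case by (simp add: has_weight_def cst_central)
next
  case (base s)
  then obtain a where "s = eU a a" by auto
  then show ?case using has_weight_eU[of a a] by simp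
next
  case (add u v)
  then show ?case by (simp add: has_weight_def distrib_left distrib_right)
next
  case (mult u v)
  then show ?case using has_weight_mult[of "\<lambda>_. 0" u "\<lambda>_. 0" v] by simp
qed

lemma has_weight_hU:
  assumes "has_weight w u"
  shows "hU h * u = u * hU h + cst (\<Sum>c\<in>UNIV. h $ c * w c) * u"
proof -
  have "cst (h $ c) * eU c c * u = u * (cst (h $ c) * eU c c) + cst (h $ c * w c) * u" for c
  proof -
    have "cst (h $ c) * eU c c * u = cst (h $ c) * (u * eU c c + cst (w c) * u)"
      using assms by (simp add: has_weight_def mult.assoc)
    then show ?thesis
      by (simp add: distrib_left cst_mult mult.assoc cst_left_commute[of u])
  qed
  then show ?thesis
    by (simp add: hU_def sum_distrib_left sum_distrib_right sum.distrib cst_sum)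
qed

lemma hvec_diff: "hvec (\<alpha> - \<beta>) = hvec \<alpha> - hvec \<beta>"
  by (simp add: hvec_eq vec_eq_iff algebra_simps)

lemma hU_diff: "hU (g - h) = hU g - hU h"
  by (simp add: hU_def cst_diff left_diff_distrib sum_subtractf)

lemma hU_hvec_chi: "hU (hvec (chi a)) = cst (sg a) * eU a a"
proof -
  have "hU (hvec (chi a)) = (\<Sum>b\<in>UNIV. if b = a then cst (sg a) * eU a a else 0)"
    unfolding hU_def hvec_eq chi_def axis_def sg_def by (intro sum.cong) auto
  then show ?thesis by simp
qed

subsection \<open>Lists\<close>

text \<open>Telescoping. Chains descend in position, hence last minus head; for an index set this
  difference is eta.\<close>

lemma sum_list_chi_differences:
  "c \<noteq> [] \<Longrightarrow> sum_list (map2 (\<lambda>a b. chi b - chi a) c (tl c)) = chi (last c) - chi (hd c)"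
proof (induction c)
  case (Cons a c)
  then show ?case by (cases c) auto
qed simp

lemma zip_tl_neq: "distinct c \<Longrightarrow> (a, b) \<in> set (zip c (tl c)) \<Longrightarrow> a \<noteq> b"
proof (induction c)
  case (Cons x c)
  then show ?case by (cases c) auto
qed simp

lemma map_fst_zip_tl: "map fst (zip c (tl c)) = butlast c"
proof (induction c)
  case (Cons x c)
  then show ?case by (cases c) auto
qed simp

lemma prod_list_power_indicator:
  "prod_list (map (\<lambda>x. g x ^ (if P x then 1 else 0)) xs) = prod_list (map g (filter P xs))"
  for g :: "'a \<Rightarrow> 'b::monoid_mult"
  by (induction xs) auto

text \<open>In a distinct list a subsequence is determined by its set of entries. This recovers the
  factors of \<open>f_elt\<close> from an order on the positive roots.\<close>

lemma filter_in_subseq: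
  assumes "subseq ys zs" "distinct zs"
  shows "filter (\<lambda>x. x \<in> set ys) zs = ys"
  using assms by (metis subseq_conv_nths filter_in_nths)

subsection \<open>The shuffle\<close>

locale shuffle_order =
  fixes xs :: "('m::{finite,linorder} + 'n::{finite,linorder}) list"
  assumes shuffle: "shuffle xs"
    and elt_first: "elt xs 1 = first_index"
    and elt_last: "elt xs (CARD('m) + CARD('n)) = last_index"
begin

definition N :: nat where "N = length xs"

abbreviation E :: "nat \<Rightarrow> nat \<Rightarrow> ('m, 'n) Ugl" where
  "E p q \<equiv> eU (elt xs p) (elt xs q)"

lemma distinct_xs: "distinct xs"
  using shuffle unfolding shuffle_def
  by (rule distinct_disjoint_shuffles[rotated 3]) (auto simp: distinct_map)

lemma set_xs: "set xs = UNIV"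
proof -
  have "set xs = range Inl \<union> range Inr"
    using set_shuffles[OF shuffle[unfolded shuffle_def]] by auto
  then show ?thesis by (simp add: UNIV_sum)
qed

lemma N_eq: "N = CARD('m) + CARD('n)"
  using distinct_card[OF distinct_xs] by (simp add: N_def set_xs)

lemma N_ge_2: "2 \<le> N"
  using N_eq zero_less_card_finite[where 'a='m] zero_less_card_finite[where 'a='n] by linarith

lemma elt_N: "elt xs N = last_index"
  using elt_last N_eq by simp

text \<open>The ranges start at 1 because \<open>elt xs 0\<close> equals \<open>elt xs 1\<close> by
  truncated subtraction.\<close>

lemma elt_eq_iff: "p \<in> {1..N} \<Longrightarrow> q \<in> {1..N} \<Longrightarrow> elt xs p = elt xs q \<longleftrightarrow> p = q"
  using nth_eq_iff_index_eq[OF distinct_xs, of "p - 1" "q - 1"]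
  unfolding elt_def N_def by (cases p; cases q) auto

lemma elt_surj: "\<exists>p\<in>{1..N}. elt xs p = a"
proof -
  have "a \<in> set xs" by (simp add: set_xs)
  then obtain i where "i < length xs" "xs ! i = a" by (auto simp: in_set_conv_nth)
  then show ?thesis by (intro bexI[of _ "Suc i"]) (auto simp: elt_def N_def)
qed

lemma bij_elt: "bij_betw (elt xs) {1..N} UNIV"
proof (rule bij_betwI')
  show "\<exists>p\<in>{1..N}. a = elt xs p" for a
    using elt_surj[of a] by blast
qed (simp_all add: elt_eq_iff)

lemma sg_first: "sg (elt xs 1) = 1"
  unfolding elt_first by (simp add: first_index_def sg_def)

lemma sg_last: "sg (elt xs N) = - 1"
  by (simp add: elt_N last_index_def sg_def)

lemma simple_root_type:
  assumes "k \<in> {1..<N}"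
  shows "simple_root xs k \<in> odd_roots \<longleftrightarrow> isl (elt xs k) \<noteq> isl (elt xs (k + 1))"
    and "simple_root xs k \<in> gl_m_roots \<longleftrightarrow> isl (elt xs k) \<and> isl (elt xs (k + 1))"
    and "simple_root xs k \<in> gl_n_roots \<longleftrightarrow> \<not> isl (elt xs k) \<and> \<not> isl (elt xs (k + 1))"
proof -
  let ?a = "elt xs k" and ?b = "elt xs (k + 1)"
  have ne: "?a \<noteq> ?b"
    using elt_eq_iff[of k "k + 1"] assms by auto
  have inj: "chi ?a - chi ?b = chi c - chi d \<longleftrightarrow> ?a = c \<and> ?b = d" for c d
    using chi_diff_inject[OF ne] by auto
  show "simple_root xs k \<in> odd_roots \<longleftrightarrow> isl ?a \<noteq> isl ?b"
    by (auto simp: simple_root_def odd_roots_def inj[simplified] odd_unit_def)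
  show "simple_root xs k \<in> gl_m_roots \<longleftrightarrow> isl ?a \<and> isl ?b"
    using ne unfolding simple_root_def gl_m_roots_def mem_Collect_eq inj by (cases ?a; cases ?b) auto
  show "simple_root xs k \<in> gl_n_roots \<longleftrightarrow> \<not> isl ?a \<and> \<not> isl ?b"
    using ne unfolding simple_root_def gl_n_roots_def mem_Collect_eq inj by (cases ?a; cases ?b) auto
qed

text \<open>The sequence starts with an unprimed index, and the parity sign flips exactly at the odd
  simple roots.\<close>

lemma sg_eq_num_odd:
  "k < N \<Longrightarrow> (- 1) ^ num_odd xs (Suc k) = sg (elt xs (Suc k))"
proof (induction k)
  case 0
  then show ?case using sg_first by (simp add: num_odd_def cong: conj_cong)
next
  case (Suc k)
  let ?P = "simple_root xs (Suc k) \<in> odd_roots"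
  have "{j. 1 \<le> j \<and> j < Suc (Suc k) \<and> simple_root xs j \<in> odd_roots}
      = {j. 1 \<le> j \<and> j < Suc k \<and> simple_root xs j \<in> odd_roots} \<union> (if ?P then {Suc k} else {})"
    by (auto simp: less_Suc_eq)
  then have "num_odd xs (Suc (Suc k)) = num_odd xs (Suc k) + (if ?P then 1 else 0)"
    unfolding num_odd_def by (simp add: card_insert_if)
  with Suc simple_root_type(1)[of "Suc k"] show ?case
    by (auto simp: sg_def)
qed

section \<open>The shifts d_k and the elements t_e in terms of parity signs\<close>

definition sign_sum :: "nat \<Rightarrow> complex" where "sign_sum j = (\<Sum>i = 1..j. sg (elt xs i))"

text \<open>Passing one simple root changes d by minus the sign of the index reached: between equal
  parities \<open>ell\<close> changes by it, between different parities \<open>ibar\<close>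
  does.\<close>

lemma d_shift_eq: "k < N \<Longrightarrow> d_shift xs (Suc k) = 1 - sign_sum (Suc k)"
proof (induction k)
  case 0
  then show ?case using sg_first by (simp add: d_shift_def ell_def ibar_def num_odd_def sign_sum_def cong: conj_cong)
next
  case (Suc k)
  have count: "card {i \<in> {1..<Suc (Suc k)}. simple_root xs i \<in> R}
      = card {i \<in> {1..<Suc k}. simple_root xs i \<in> R}
        + (if simple_root xs (Suc k) \<in> R then 1 else 0)" for R
  proof -
    have "{i \<in> {1..<Suc (Suc k)}. simple_root xs i \<in> R}
      = {i \<in> {1..<Suc k}. simple_root xs i \<in> R}
        \<union> (if simple_root xs (Suc k) \<in> R then {Suc k} else {})"
      by (auto simp: less_Suc_eq)
    then show ?thesis by (simp add: card_insert_if)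
  qed
  have ibar: "ibar xs (Suc j) = (1 - sg (elt xs (Suc j))) / 2" if "j < N" for j
    using sg_eq_num_odd[OF that] by (simp add: ibar_def)
  have "d_shift xs (Suc (Suc k)) = d_shift xs (Suc k) - sg (elt xs (Suc (Suc k)))"
    using Suc.prems simple_root_type(2,3)[of "Suc k"]
    unfolding d_shift_def ell_def count
    by (auto simp: ibar sg_def)
  with Suc show ?case by (simp add: sign_sum_def)
qed

lemma s_elt_eq: "s_elt xs j = hvec (chi (elt xs 1)) - hvec (chi (elt xs (Suc j)))"
  by (induction j) (simp_all add: s_elt_def simple_root_def hvec_diff)

lemma t_elt_eq:
  assumes "1 \<le> j" "j < N"
  shows "t_elt xs j = cst (sg (elt xs (Suc j))) * (E 1 1 + cst (sign_sum j - 1)) - E (Suc j) (Suc j)"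
proof -
  have d: "d_shift xs j = 1 - sign_sum j"
    using d_shift_eq[of "j - 1"] assms by simp
  have "(- 1) ^ num_odd xs (j + 1) = (cst (sg (elt xs (Suc j))) :: ('m, 'n) Ugl)"
    using arg_cong[OF sg_eq_num_odd[OF assms(2)], of cst] by (simp add: cst_power cst_minus cst_1)
  \<comment> \<open>The outer sign of \<open>t_elt\<close> cancels the sign in
    \<open>hU_hvec_chi\<close>, so that \<open>E (Suc j) (Suc j)\<close> has coefficient -1.\<close>
  moreover have "cst (sg (elt xs (Suc j))) * (cst (sg (elt xs (Suc j))) * u) = u"
    for u :: "('m, 'n) Ugl"
    by (simp add: mult.assoc[symmetric] cst_mult[symmetric] cst_1)
  ultimately show ?thesis
    using sg_first
    by (simp add: t_elt_def d s_elt_eq hU_diff hU_hvec_chi cst_1 right_diff_distrib distrib_left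
        cst_diff)
qed

text \<open>Here \<open>t_elt xs k\<close> belongs to the position k + 1. The summand 1 is the
  square of the sign of x_k, by which \<open>sign_sum\<close> grows; for k = 1 nothing is left over
  because \<open>sign_sum 1 = 1\<close>.\<close>

lemma t_elt_step:
  assumes "1 \<le> k" "k < N"
  shows "cst (sg (elt xs k) * sg (elt xs (Suc k))) * t_elt xs k
    = (if k = 1 then 0 else t_elt xs (k - 1) + 1)
      + (E k k - cst (sg (elt xs k) * sg (elt xs (Suc k))) * E (Suc k) (Suc k))"
proof -
  let ?a = "sg (elt xs k)" and ?b = "sg (elt xs (Suc k))"
  have "cst (?a * ?b) * (cst ?b * u) = cst ?a * u" for u :: "('m, 'n) Ugl"
    by (simp add: mult.assoc[symmetric] cst_mult[symmetric])
      (simp add: mult.assoc)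
  then have *: "cst (?a * ?b) * t_elt xs k
      = cst ?a * (E 1 1 + cst (sign_sum k - 1)) - cst (?a * ?b) * E (Suc k) (Suc k)"
    using assms by (simp add: t_elt_eq right_diff_distrib)
  show ?thesis
  proof (cases "k = 1")
    case True
    then show ?thesis using * sg_first by (simp add: sign_sum_def cst_1)
  next
    case False
    then obtain j where j: "k = Suc j" "1 \<le> j" using assms by (cases k) auto
    have sign_sum: "cst ?a * cst (sign_sum k - 1) = (cst ?a * cst (sign_sum j - 1) + 1 :: ('m, 'n) Ugl)"
      unfolding cst_1[symmetric] cst_mult[symmetric] cst_add[symmetric]
      by (simp add: sign_sum_def j algebra_simps)
    have "t_elt xs (k - 1) = cst ?a * (E 1 1 + cst (sign_sum j - 1)) - E k k"
      using t_elt_eq[of j] j assms by simp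
    then show ?thesis
      unfolding * distrib_left sign_sum using False by simp
  qed
qed

subsection \<open>Partial sums of \<open>\<Theta>\<close>\<close>

text \<open>
  \<open>partial_Theta p\<close> is the analogue of \<open>\<Theta>\<close> for the initial segment \<open>x\<^sub>1, \<dots>, x\<^sub>p\<close> of the shuffle.
\<close>

definition initial_index_sets :: "nat \<Rightarrow> ('m + 'n) set set" where
  "initial_index_sets p = {J. elt xs 1 \<in> J \<and> elt xs p \<in> J \<and> J \<subseteq> elt xs ` {1..p}}"

definition H_upto :: "nat \<Rightarrow> ('m + 'n) set \<Rightarrow> ('m, 'n) Ugl" where
  "H_upto p J = prod_list (map (t_elt xs) (filter (\<lambda>j. elt xs (j + 1) \<notin> J) [1..<p - 1]))"

definition partial_Theta :: "nat \<Rightarrow> ('m, 'n) Ugl" where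
  "partial_Theta p = (\<Sum>J\<in>initial_index_sets p. f_elt xs J * H_upto p J)"

text \<open>By the shift in \<open>t_elt\<close>, these are the factors of the positions strictly
  between q and p; the product is empty for p = q + 1.\<close>

definition t_prod :: "nat \<Rightarrow> nat \<Rightarrow> ('m, 'n) Ugl" where
  "t_prod q p = prod_list (map (t_elt xs) [q..<p - 1])"

lemma Theta_eq: "Theta xs = partial_Theta N"
proof -
  have "elt xs ` {1..N} = UNIV"
    using bij_elt by (simp add: bij_betw_def)
  then have "initial_index_sets N = index_sets"
    using elt_first elt_N by (simp add: initial_index_sets_def index_sets_def)
  moreover have "H_upto N J = H_elt xs J" for J
    by (simp add: H_upto_def H_elt_def N_def)
  ultimately show ?thesis by (simp add: partial_Theta_def Theta_def)
qed

text \<open>Chains run by descending position, so a new highest index becomes the head. The proof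
  cuts xs at position p; nothing behind the cut survives the filter.\<close>

lemma chain_insert:
  assumes "1 \<le> p" "p \<le> N" "J \<subseteq> elt xs ` {1..<p}"
  shows "chain xs (insert (elt xs p) J) = elt xs p # chain xs J"
proof -
  have p: "p - 1 < length xs" using assms by (simp add: N_def)
  have xs: "xs = take (p - 1) xs @ elt xs p # drop p xs"
    using id_take_nth_drop[OF p] assms(1) by (simp add: elt_def)
  have drop: "x \<notin> J \<and> x \<noteq> elt xs p" if x: "x \<in> set (drop p xs)" for x
  proof -
    obtain i where "i < length (drop p xs)" "drop p xs ! i = x"
      using x unfolding in_set_conv_nth by blast
    then have i: "x = elt xs (Suc (p + i))" "Suc (p + i) \<le> N"
      by (auto simp: elt_def N_def)
    then have "x \<noteq> elt xs r" if "r \<in> {1..p}" for r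
      using that assms elt_eq_iff[of "Suc (p + i)" r] by auto
    then have "x \<notin> elt xs ` {1..p}" by blast
    moreover have "J \<union> {elt xs p} \<subseteq> elt xs ` {1..p}" using assms by auto
    ultimately show ?thesis by blast
  qed
  have take: "x \<noteq> elt xs p" if "x \<in> set (take (p - 1) xs)" for x
    using distinct_xs that by (subst (asm) xs) auto
  have p_notin: "elt xs p \<notin> J"
    using assms elt_eq_iff[of p] by force
  have 1: "filter (\<lambda>a. a \<in> insert (elt xs p) J) (rev (drop p xs)) = []"
    "filter (\<lambda>a. a \<in> J) (rev (drop p xs)) = []"
    using drop by (auto simp: filter_empty_conv)
  have 2: "filter (\<lambda>a. a \<in> insert (elt xs p) J) (rev (take (p - 1) xs))
      = filter (\<lambda>a. a \<in> J) (rev (take (p - 1) xs))"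
    using take by (intro filter_cong) auto
  have rev: "rev xs = rev (drop p xs) @ elt xs p # rev (take (p - 1) xs)"
    by (subst xs) simp
  show ?thesis
    unfolding chain_def rev using 1 2 p_notin by simp
qed

lemma chain_initial_index_set:
  assumes "1 \<le> q" "q \<le> N" "J \<in> initial_index_sets q"
  obtains c where "chain xs J = elt xs q # c"
proof -
  have "J - {elt xs q} \<subseteq> elt xs ` {1..<q}"
  proof
    fix x assume x: "x \<in> J - {elt xs q}"
    then obtain i where "i \<in> {1..q}" "x = elt xs i" using assms(3) by (auto simp: initial_index_sets_def)
    moreover from this x have "i \<noteq> q" by blast
    ultimately show "x \<in> elt xs ` {1..<q}" by auto
  qed
  from chain_insert[OF assms(1,2) this] have "chain xs J = elt xs q # chain xs (J - {elt xs q})"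
    using assms(3) by (simp add: initial_index_sets_def insert_absorb)
  then show ?thesis by (rule that)
qed

lemma partial_Theta_1: "partial_Theta 1 = 1"
proof -
  have "initial_index_sets 1 = {{elt xs 1}}" by (auto simp: initial_index_sets_def)
  moreover have "chain xs {elt xs 1} = [elt xs 1]"
  proof -
    have "chain xs {} = []" by (simp add: chain_def)
    then show ?thesis using chain_insert[of 1 "{}"] N_ge_2 by simp
  qed
  ultimately show ?thesis by (simp add: partial_Theta_def f_elt_def H_upto_def)
qed

text \<open>Deleting x_p from an index set leaves one whose highest position q is the second element
  of the chain. This is the splitting behind the recursion for \<open>partial_Theta\<close>.\<close>

lemma bij_initial_index_sets:
  assumes "2 \<le> p" "p \<le> N"
  shows "bij_betw (\<lambda>(q, J). insert (elt xs p) J) (Sigma {1..<p} initial_index_sets) (initial_index_sets p)"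
  unfolding bij_betw_def
proof
  have notin: "elt xs p \<notin> J" if "q \<in> {1..<p}" "J \<in> initial_index_sets q" for q J
    using that assms elt_eq_iff[of p] by (force simp: initial_index_sets_def)
  \<comment> \<open>Used in both directions: q is the highest position in J, hence determined by
    J.\<close>
  have le: "q \<le> q'" if "q \<in> {1..<p}" "q' \<in> {1..<p}" "J \<in> initial_index_sets q" "J \<in> initial_index_sets q'" for q q' J
  proof -
    have "elt xs q \<in> elt xs ` {1..q'}" using that(3,4) unfolding initial_index_sets_def by blast
    then obtain r where "r \<in> {1..q'}" "elt xs q = elt xs r" by blast
    then show ?thesis using elt_eq_iff[of q r] that assms by auto
  qed
  show "inj_on (\<lambda>(q, J). insert (elt xs p) J) (Sigma {1..<p} initial_index_sets)"
  proof (rule inj_onI, clarify)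
    fix q J q' J'
    assume *: "q \<in> {1..<p}" "J \<in> initial_index_sets q" "q' \<in> {1..<p}" "J' \<in> initial_index_sets q'"
      "insert (elt xs p) J = insert (elt xs p) J'"
    have "J = insert (elt xs p) J - {elt xs p}" using notin[OF *(1,2)] by simp
    also have "\<dots> = J'" using notin[OF *(3,4)] by (simp add: *(5))
    finally have "J = J'" .
    then show "q = q' \<and> J = J'" using le[of q q' J] le[of q' q J] * by auto
  qed
  show "(\<lambda>(q, J). insert (elt xs p) J) ` Sigma {1..<p} initial_index_sets = initial_index_sets p"
  proof (intro equalityI subsetI)
    fix J assume "J \<in> (\<lambda>(q, J). insert (elt xs p) J) ` Sigma {1..<p} initial_index_sets"
    then show "J \<in> initial_index_sets p" using assms by (fastforce simp: initial_index_sets_def)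
  next
    fix J assume J: "J \<in> initial_index_sets p"
    define I where "I = {i \<in> {1..<p}. elt xs i \<in> J}"
    \<comment> \<open>The position of the second chain element; it exists since p is at least 2 and
      x_1 lies in J.\<close>
    define q where "q = Max I"
    have I: "finite I" "1 \<in> I" using J assms by (auto simp: I_def initial_index_sets_def)
    have "J - {elt xs p} \<in> initial_index_sets q"
    proof -
      have "q \<in> I" using I unfolding q_def by (metis Max_in empty_iff)
      moreover have "elt xs i \<noteq> elt xs p" if "i \<in> {1..<p}" for i
        using that assms elt_eq_iff[of i p] by auto
      moreover have "x \<in> elt xs ` {1..q}" if x: "x \<in> J - {elt xs p}" for x
      proof -
        obtain i where i: "x = elt xs i" "i \<in> {1..p}" using J x by (auto simp: initial_index_sets_def)
        then have "i \<in> I" using x by (auto simp: I_def nat_less_le)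
        then show ?thesis using I i by (auto simp: q_def)
      qed
      ultimately show ?thesis using J I unfolding initial_index_sets_def I_def by auto
    qed
    moreover have "q \<in> {1..<p}"
      using Max_in[OF I(1)] I(2) unfolding q_def[symmetric] by (auto simp: I_def)
    moreover have "J = insert (elt xs p) (J - {elt xs p})"
      using J by (auto simp: initial_index_sets_def)
    ultimately show "J \<in> (\<lambda>(q, J). insert (elt xs p) J) ` Sigma {1..<p} initial_index_sets"
      by (intro image_eqI[of _ _ "(q, J - {elt xs p})"]) auto
  qed
qed

lemma partial_Theta_rec:
  assumes "2 \<le> p" "p \<le> N"
  shows "partial_Theta p = (\<Sum>q\<in>{1..<p}. E p q * partial_Theta q * t_prod q p)"
proof -
  have finite_initial: "finite (initial_index_sets q)" for q
    by (rule finite_subset[of _ "Pow (elt xs ` {1..q})"]) (auto simp: initial_index_sets_def)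
  have summand: "f_elt xs (insert (elt xs p) J) * H_upto p (insert (elt xs p) J)
      = E p q * (f_elt xs J * H_upto q J) * t_prod q p"
    if q: "q \<in> {1..<p}" and J: "J \<in> initial_index_sets q" for q J
  proof -
    obtain c where c: "chain xs J = elt xs q # c"
      using chain_initial_index_set[of q J] q J assms by auto
    have "J \<subseteq> elt xs ` {1..<p}" using q J by (auto simp: initial_index_sets_def)
    then have "chain xs (insert (elt xs p) J) = elt xs p # elt xs q # c"
      using chain_insert[of p J] assms c by simp
    then have f: "f_elt xs (insert (elt xs p) J) = E p q * f_elt xs J"
      by (simp add: f_elt_def c)
    let ?P = "\<lambda>j. elt xs (j + 1) \<notin> insert (elt xs p) J" and ?Q = "\<lambda>j. elt xs (j + 1) \<notin> J"
    have low: "filter ?P [1..<q - 1] = filter ?Q [1..<q - 1]"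
      using q assms by (intro filter_cong) (auto simp: elt_eq_iff)
    have high: "filter ?P [q..<p - 1] = [q..<p - 1]"
    proof -
      have "?P j" if "j \<in> set [q..<p - 1]" for j
      proof -
        have "elt xs (j + 1) \<noteq> elt xs r" if "r \<in> insert p {1..q}" for r
        proof -
          have "j + 1 \<in> {1..N}" "r \<in> {1..N}" "j + 1 \<noteq> r"
            using \<open>j \<in> _\<close> that q assms by auto
          then show ?thesis by (simp add: elt_eq_iff)
        qed
        then have "elt xs (j + 1) \<notin> elt xs ` insert p {1..q}" by blast
        moreover have "insert (elt xs p) J \<subseteq> elt xs ` insert p {1..q}" using J by (auto simp: initial_index_sets_def)
        ultimately show ?thesis by blast
      qed
      then show ?thesis by (simp add: filter_id_conv)
    qed
    \<comment> \<open>The number q - 1 stands for x_q, which lies in J, and so drops out between the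
      two ranges. For q = 1 it would be 0, which is outside the range.\<close>
    have "filter ?P [1..<p - 1] = filter ?Q [1..<q - 1] @ [q..<p - 1]"
    proof (cases "q = 1")
      case True
      then show ?thesis using high by simp
    next
      case False
      then have "1 \<le> q - 1" using q by auto
      then have "[1..<p - 1] = [1..<q - 1] @ [q - 1..<p - 1]"
        using q upt_add_eq_append[of 1 "q - 1" "p - q"] by simp
      moreover have "[q - 1..<p - 1] = (q - 1) # [q..<p - 1]"
        using q False by (subst upt_conv_Cons) auto
      moreover have "\<not> ?P (q - 1)" using J q by (simp add: initial_index_sets_def)
      ultimately show ?thesis using low high by simp
    qed
    then have "H_upto p (insert (elt xs p) J) = H_upto q J * t_prod q p"
      by (simp add: H_upto_def t_prod_def)
    with f show ?thesis by (simp add: mult.assoc)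
  qed
  have "partial_Theta p = (\<Sum>z\<in>Sigma {1..<p} initial_index_sets. case z of (q, J) \<Rightarrow> E p q * (f_elt xs J * H_upto q J) * t_prod q p)"
    unfolding partial_Theta_def
    by (subst sum.reindex_bij_betw[OF bij_initial_index_sets[OF assms], symmetric])
      (intro sum.cong, auto simp: summand)
  also have "\<dots> = (\<Sum>q\<in>{1..<p}. \<Sum>J\<in>initial_index_sets q. E p q * (f_elt xs J * H_upto q J) * t_prod q p)"
    using finite_initial by (subst sum.Sigma) auto
  also have "\<dots> = (\<Sum>q\<in>{1..<p}. E p q * partial_Theta q * t_prod q p)"
    by (simp add: partial_Theta_def sum_distrib_left sum_distrib_right)
  finally show ?thesis .
qed

lemma t_prod_in_U_h: "t_prod q p \<in> U_h"
  unfolding t_prod_def by (rule prod_list_t_elt_in_U_h)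

lemma t_prod_snoc: "q < k \<Longrightarrow> t_prod q (Suc k) = t_prod q k * t_elt xs (k - 1)"
proof -
  assume "q < k"
  then have "[q..<k] = [q..<k - 1] @ [k - 1]"
    using upt_Suc_append[of q "k - 1"] by simp
  then show ?thesis by (simp add: t_prod_def)
qed

lemma t_prod_Cons: "Suc k < p \<Longrightarrow> t_prod k p = t_elt xs k * t_prod (Suc k) p"
  by (simp add: t_prod_def upt_conv_Cons)

text \<open>The weights telescope along the recursion, the factors t having weight 0. Besides the
  weight of \<open>Theta\<close>, this governs moving Cartan elements past the partial sums.\<close>

lemma has_weight_partial_Theta:
  "1 \<le> p \<Longrightarrow> p \<le> N \<Longrightarrow>
    has_weight (\<lambda>c. (if c = elt xs p then 1 else 0) - (if c = elt xs 1 then 1 else 0)) (partial_Theta p)"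
proof (induction p rule: less_induct)
  case (less p)
  show ?case
  proof (cases "p = 1")
    case True
    then show ?thesis by (simp add: partial_Theta_1[simplified] has_weight_def)
  next
    case False
    have "has_weight (\<lambda>c. (if c = elt xs p then 1 else 0) - (if c = elt xs 1 then 1 else 0))
        (E p q * partial_Theta q * t_prod q p)" if "q \<in> {1..<p}" for q
    proof (rule back_subst[of "\<lambda>w. has_weight w (E p q * partial_Theta q * t_prod q p)"])
      show "has_weight (\<lambda>c. ((if c = elt xs p then 1 else 0) - (if c = elt xs q then 1 else 0)
          + ((if c = elt xs q then 1 else 0) - (if c = elt xs 1 then 1 else 0))) + 0)
        (E p q * partial_Theta q * t_prod q p)"
        using that less by (intro has_weight_mult has_weight_eU has_weight_U_h t_prod_in_U_h) auto
    qed (auto simp: fun_eq_iff)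
    then show ?thesis
      using partial_Theta_rec[of p] False less.prems by (auto intro!: has_weight_sum)
  qed
qed

subsection \<open>The action of the positive root vectors\<close>

abbreviation L :: "('m, 'n) Ugl set" where
  "L \<equiv> left_ideal (n_plus_basis xs)"

definition E_sign :: "nat \<Rightarrow> nat \<Rightarrow> nat \<Rightarrow> nat \<Rightarrow> complex" where
  "E_sign p q r s = koszul_sign (elt xs p) (elt xs q) (elt xs r) (elt xs s)"

lemma E_commute:
  assumes "p \<in> {1..N}" "q \<in> {1..N}" "r \<in> {1..N}" "s \<in> {1..N}"
  shows "E p q * E r s = cst (E_sign p q r s) * (E r s * E p q)
    + (if q = r then E p s else 0) - cst (E_sign p q r s) * (if p = s then E r q else 0)"
  using eU_commute[of "elt xs p" "elt xs q" "elt xs r" "elt xs s"] assms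
  by (simp add: elt_eq_iff E_sign_def)

lemma E_in_n_plus: "1 \<le> p \<Longrightarrow> p < q \<Longrightarrow> q \<le> N \<Longrightarrow> E p q \<in> n_plus_basis xs"
  by (auto simp: n_plus_basis_def N_def)

lemma L_mult_t_prod: "x \<in> L \<Longrightarrow> x * t_prod q p \<in> L"
  by (rule left_ideal_U_h_mult_right[OF t_prod_in_U_h])

text \<open>Strong induction: \<open>E k (Suc k)\<close> is commuted past \<open>E p q\<close> in
  each summand of the recursion. Commutators survive only for p = k + 1 or q = k, and the term
  acting on \<open>partial_Theta q\<close> is exceptional only for q = k + 1. That term needs the
  first branch as induction hypothesis, so both branches are proved together.\<close>

lemma E_simple_partial_Theta:
  assumes "1 \<le> k" "k < N" "1 \<le> p" "p \<le> N"
  shows "if Suc k = p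
    then E k (Suc k) * partial_Theta p - partial_Theta k * (cst (sg (elt xs k) * sg (elt xs p)) * t_elt xs k) \<in> L
    else E k (Suc k) * partial_Theta p \<in> L"
  using assms(3,4)
proof (induction p rule: less_induct)
  case (less p)
  show ?case
  proof (cases "p = 1")
    case True
    then show ?thesis
      using assms left_ideal_base[OF E_in_n_plus[of k "Suc k"], of 1] partial_Theta_1 by simp
  next
    case False
    then have p: "2 \<le> p" "p \<le> N" using less.prems by auto
    define B where "B q = E k (Suc k) * (E p q * partial_Theta q * t_prod q p)" for q
    have sum: "E k (Suc k) * partial_Theta p = (\<Sum>q\<in>{1..<p}. B q)"
      by (simp add: partial_Theta_rec[OF p] B_def sum_distrib_left)
    have B: "B q = cst (E_sign k (Suc k) p q) * (E p q * (E k (Suc k) * partial_Theta q * t_prod q p))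
        + (if Suc k = p then E k q * partial_Theta q * t_prod q p else 0)
        - cst (E_sign k (Suc k) p q) * (if k = q then E p (Suc k) * partial_Theta q * t_prod q p else 0)"
      if "q \<in> {1..<p}" for q
    proof -
      have "B q = (E k (Suc k) * E p q) * (partial_Theta q * t_prod q p)"
        by (simp add: B_def mult.assoc)
      also have "E k (Suc k) * E p q = cst (E_sign k (Suc k) p q) * (E p q * E k (Suc k))
          + (if Suc k = p then E k q else 0)
          - cst (E_sign k (Suc k) p q) * (if k = q then E p (Suc k) else 0)"
        using that p assms by (intro E_commute) auto
      finally show ?thesis
        by (auto simp: distrib_right left_diff_distrib mult.assoc)
    qed
    have main: "cst c * (E p q * (E k (Suc k) * partial_Theta q * t_prod q p)) \<in> L"
      if "q \<in> {1..<p}" "Suc k \<noteq> q" for q c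
    proof -
      have "E k (Suc k) * partial_Theta q \<in> L"
        using less.IH[of q] that p by simp
      then show ?thesis by (rule left_ideal_mult_left[OF left_ideal_mult_left[OF L_mult_t_prod]])
    qed
    show ?thesis
    proof (cases "Suc k = p")
      case True
      let ?\<kappa> = "sg (elt xs k) * sg (elt xs p)"
      have \<kappa>: "E_sign k p p k = ?\<kappa>"
        unfolding E_sign_def True by (rule koszul_sign_swap)
      have k: "{1..<p} = insert k {1..<k}" using True assms by auto
      have t_prod: "t_prod k p = 1" using True by (auto simp: t_prod_def)
      \<comment> \<open>By its weight, \<open>partial_Theta k\<close> gains an extra copy from
        \<open>E k k\<close> unless k = 1, where the weight is 0. It commutes with
        \<open>E p p\<close>, as p is neither k nor 1.\<close>
      have comm: "(E k k - cst ?\<kappa> * E p p) * partial_Theta k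
          = partial_Theta k * ((if k = 1 then 0 else 1) + (E k k - cst ?\<kappa> * E p p))"
      proof -
        have "E k k * partial_Theta k = partial_Theta k * E k k + (if k = 1 then 0 else partial_Theta k)"
          using has_weight_partial_Theta[of k] assms elt_eq_iff[of k 1] by (auto simp: has_weight_def cst_1)
        moreover have "E p p * partial_Theta k = partial_Theta k * E p p"
          using has_weight_partial_Theta[of k] assms elt_eq_iff[of k p] elt_eq_iff[of p 1] p True
          by (auto simp: has_weight_def)
        ultimately show ?thesis
          by (simp add: left_diff_distrib right_diff_distrib distrib_left mult.assoc
              cst_left_commute[of "partial_Theta k"])
      qed
      \<comment> \<open>The gap between q and p = k + 1 includes the position k. Its factor
        \<open>t_elt xs (k - 1)\<close> is pulled out, leaving the recursion for
        \<open>partial_Theta k\<close>; for k = 1 the sum is empty.\<close>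
      have *: "(\<Sum>q\<in>{1..<k}. E k q * partial_Theta q * t_prod q p) = (if k = 1 then 0 else partial_Theta k * t_elt xs (k - 1))"
      proof (cases "k = 1")
        case False
        have "t_prod q p = t_prod q k * t_elt xs (k - 1)" if "q \<in> {1..<k}" for q
          using t_prod_snoc[of q k] that True by auto
        then have "(\<Sum>q\<in>{1..<k}. E k q * partial_Theta q * t_prod q p)
            = (\<Sum>q\<in>{1..<k}. E k q * partial_Theta q * t_prod q k) * t_elt xs (k - 1)"
          by (simp add: sum_distrib_right mult.assoc)
        then show ?thesis using partial_Theta_rec[of k] False assms by simp
      qed simp
      \<comment> \<open>The commutator terms add up exactly to the subtracted product, so only terms
        covered by \<open>main\<close> remain.\<close>
      have "(\<Sum>q\<in>{1..<p}. B q) - partial_Theta k * (cst ?\<kappa> * t_elt xs k)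
          = (\<Sum>q\<in>{1..<p}. cst (E_sign k p p q) * (E p q * (E k (Suc k) * partial_Theta q * t_prod q p)))"
      proof -
        have "(\<Sum>q\<in>{1..<p}. B q) = (\<Sum>q\<in>{1..<p}.
              cst (E_sign k p p q) * (E p q * (E k (Suc k) * partial_Theta q * t_prod q p))
              + E k q * partial_Theta q * t_prod q p - (if k = q then cst ?\<kappa> * (E p p * partial_Theta k) else 0))"
          using True t_prod \<kappa> by (intro sum.cong) (auto simp: B)
        also have "\<dots> = (\<Sum>q\<in>{1..<p}. cst (E_sign k p p q) * (E p q * (E k (Suc k) * partial_Theta q * t_prod q p)))
              + (\<Sum>q\<in>{1..<p}. E k q * partial_Theta q * t_prod q p) - cst ?\<kappa> * (E p p * partial_Theta k)"
          using assms True by (simp add: sum.distrib sum_subtractf)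
        finally have split: "(\<Sum>q\<in>{1..<p}. B q)
            = (\<Sum>q\<in>{1..<p}. cst (E_sign k p p q) * (E p q * (E k (Suc k) * partial_Theta q * t_prod q p)))
              + (\<Sum>q\<in>{1..<p}. E k q * partial_Theta q * t_prod q p) - cst ?\<kappa> * (E p p * partial_Theta k)" .
        have "(\<Sum>q\<in>{1..<p}. E k q * partial_Theta q * t_prod q p) - cst ?\<kappa> * (E p p * partial_Theta k)
            = (if k = 1 then 0 else partial_Theta k * t_elt xs (k - 1)) + (E k k - cst ?\<kappa> * E p p) * partial_Theta k"
          unfolding k using * t_prod by (simp add: left_diff_distrib mult.assoc)
        \<comment> \<open>After \<open>comm\<close> all right factors add up to the right-hand side
          of \<open>t_elt_step\<close>, whose summand 1 is the contribution of the weight.\<close>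
        also have "\<dots> = partial_Theta k * (cst ?\<kappa> * t_elt xs k)"
          unfolding comm
          unfolding True[symmetric] t_elt_step[OF assms(1,2)] by (simp add: distrib_left)
        finally show ?thesis unfolding split by (simp add: algebra_simps)
      qed
      moreover have "\<dots> \<in> L"
        using True by (intro left_ideal_sum main) auto
      ultimately show ?thesis unfolding sum using True by simp
    next
      case False
      have other: "B q \<in> L" if "q \<in> {1..<p} - {k, Suc k}" for q
        using B[of q] main[of q] that False by simp
      show ?thesis
      proof (cases "Suc k < p")
        case True
        \<comment> \<open>The exceptional summands cancel modulo \<open>L\<close>. The commutator in
          \<open>B k\<close> and the induction hypothesis in \<open>B (Suc k)\<close> give opposite
          multiples of \<open>E p (Suc k) * partial_Theta k * t_prod k p\<close>: the missing factor
          \<open>t_elt xs k\<close> comes from the hypothesis, and the signs agree by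
          \<open>koszul_sign_shift\<close>.\<close>
        have "B k + B (Suc k) \<in> L"
        proof -
          let ?\<kappa> = "E_sign k (Suc k) p k" and ?\<kappa>' = "E_sign k (Suc k) p (Suc k)"
            and ?s = "sg (elt xs k) * sg (elt xs (Suc k))"
          have s: "?\<kappa>' * ?s = ?\<kappa>"
            unfolding E_sign_def by (rule koszul_sign_shift)
          let ?y = "E k (Suc k) * partial_Theta (Suc k) - partial_Theta k * (cst ?s * t_elt xs k)"
          have y: "?y \<in> L"
            using less.IH[of "Suc k"] True p by simp
          have "B (Suc k) = cst ?\<kappa>' * (E p (Suc k) * (?y * t_prod (Suc k) p))
              + cst ?\<kappa>' * (E p (Suc k) * (partial_Theta k * (cst ?s * t_elt xs k) * t_prod (Suc k) p))"
            using B[of "Suc k"] True by (simp add: algebra_simps)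
          also have "cst ?\<kappa>' * (E p (Suc k) * (partial_Theta k * (cst ?s * t_elt xs k) * t_prod (Suc k) p))
              = cst ?\<kappa> * (E p (Suc k) * partial_Theta k * t_prod k p)"
            using s t_prod_Cons[OF True]
            by (simp add: mult.assoc cst_left_commute[of "partial_Theta k"] cst_left_commute[of "E p (Suc k)"])
              (simp add: mult.assoc[symmetric] cst_mult[symmetric])
          finally have "B k + B (Suc k)
              = cst ?\<kappa> * (E p k * (E k (Suc k) * partial_Theta k * t_prod k p))
                + cst ?\<kappa>' * (E p (Suc k) * (?y * t_prod (Suc k) p))"
            using B[of k] assms True by simp
          also have "\<dots> \<in> L"
            using main[of k "E_sign k (Suc k) p k"] assms True
            by (intro left_ideal_add left_ideal_mult_left[OF left_ideal_mult_left[OF L_mult_t_prod[OF y]]])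
              auto
          finally show ?thesis .
        qed
        moreover have "(\<Sum>q\<in>{1..<p} - {k, Suc k}. B q) \<in> L"
          using other by (rule left_ideal_sum)
        moreover have "(\<Sum>q\<in>{1..<p}. B q) = (B k + B (Suc k)) + (\<Sum>q\<in>{1..<p} - {k, Suc k}. B q)"
          using assms True sum.subset_diff[of "{k, Suc k}" "{1..<p}" B] by (simp add: add.commute)
        ultimately have "(\<Sum>q\<in>{1..<p}. B q) \<in> L"
          by (simp add: left_ideal_add)
        then show ?thesis unfolding sum using False by simp
      next
        case ge: False
        \<comment> \<open>Now p is at most k, so q reaches neither k nor k + 1.\<close>
        have "B q \<in> L" if "q \<in> {1..<p}" for q
          using other[of q] that ge False by auto
        then have "(\<Sum>q\<in>{1..<p}. B q) \<in> L" by (rule left_ideal_sum)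
        then show ?thesis unfolding sum using False by simp
      qed
    qed
  qed
qed

section \<open>The element h_eta and the value of rho on it\<close>

lemma hU_hvec_eta: "hU (hvec eta) = E 1 1 + E N N"
proof -
  have "hU (hvec eta) = cst (sg (elt xs 1)) * E 1 1 - cst (sg (elt xs N)) * E N N"
    by (simp only: eta_def elt_first[symmetric] elt_N[symmetric] hvec_diff hU_diff hU_hvec_chi)
  then show ?thesis
    unfolding sg_first sg_last by (simp add: cst_minus cst_1)
qed

lemma pos_roots_eq:
  "pos_roots xs = (\<lambda>(p, q). chi (elt xs p) - chi (elt xs q)) ` (SIGMA p:{1..N}. {Suc p..N})"
  by (force simp: pos_roots_def N_def)

lemma finite_pos_roots: "finite (pos_roots xs)"
  by (simp add: pos_roots_eq)

lemma sum_pos_roots: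
  "(\<Sum>\<alpha>\<in>pos_roots xs. f \<alpha>)
    = (\<Sum>p = 1..N. \<Sum>q = Suc p..N. f (chi (elt xs p) - chi (elt xs q)))"
proof -
  have "inj_on (\<lambda>(p, q). chi (elt xs p) - chi (elt xs q)) (SIGMA p:{1..N}. {Suc p..N})"
  proof (rule inj_onI, clarify)
    fix p q p' q'
    assume *: "p \<in> {1..N}" "q \<in> {Suc p..N}" "p' \<in> {1..N}" "q' \<in> {Suc p'..N}"
      and eq: "chi (elt xs p) - chi (elt xs q) = chi (elt xs p') - chi (elt xs q')"
    have "elt xs p \<noteq> elt xs q" using * elt_eq_iff[of p q] by auto
    from chi_diff_inject[OF this eq] show "p = p' \<and> q = q'"
      using * elt_eq_iff[of p p'] elt_eq_iff[of q q'] by auto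
  qed
  then have "(\<Sum>\<alpha>\<in>pos_roots xs. f \<alpha>) = (\<Sum>(p, q)\<in>(SIGMA p:{1..N}. {Suc p..N}).
      f (chi (elt xs p) - chi (elt xs q)))"
    unfolding pos_roots_eq by (subst sum.reindex) (auto intro: sum.cong)
  then show ?thesis by (subst sum.Sigma) auto
qed

text \<open>The product of the two signs is 1 on even and -1 on odd roots, which turns rho into half
  of one signed sum over all pairs of positions.\<close>

lemma rho_component:
  "rho xs $ a = (\<Sum>p = 1..N. \<Sum>q = Suc p..N.
     sg (elt xs p) * sg (elt xs q) * (chi (elt xs p) - chi (elt xs q)) $ a) / 2"
proof -
  define c :: "('m, 'n) weight \<Rightarrow> complex"
    where "c \<alpha> = (if \<alpha> \<in> even_roots then 1 else 0) - (if \<alpha> \<in> odd_roots then 1 else 0)" for \<alpha>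
  have c: "c (chi x - chi y) = sg x * sg y" if "x \<noteq> y" for x y :: "'m + 'n"
  proof -
    have "chi x - chi y \<in> even_roots \<longleftrightarrow> \<not> odd_unit x y"
      using chi_diff_inject[OF that] that by (auto simp: even_roots_def)
    moreover have "chi x - chi y \<in> odd_roots \<longleftrightarrow> odd_unit x y"
      using chi_diff_inject[OF that] by (auto simp: odd_roots_def)
    ultimately show ?thesis by (auto simp: c_def odd_unit_def sg_def)
  qed
  have "rho xs $ a = ((\<Sum>\<alpha>\<in>pos_roots xs \<inter> even_roots. \<alpha> $ a)
      - (\<Sum>\<alpha>\<in>pos_roots xs \<inter> odd_roots. \<alpha> $ a)) / 2"
    by (simp add: rho_def diff_divide_distrib)
  also have "\<dots> = (\<Sum>\<alpha>\<in>pos_roots xs. c \<alpha> * \<alpha> $ a) / 2"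
    unfolding sum.inter_restrict[OF finite_pos_roots] sum_subtractf[symmetric]
    by (intro arg_cong[of _ _ "\<lambda>x. x / 2"] sum.cong) (auto simp: c_def)
  also have "(\<Sum>\<alpha>\<in>pos_roots xs. c \<alpha> * \<alpha> $ a) = (\<Sum>p = 1..N. \<Sum>q = Suc p..N.
      sg (elt xs p) * sg (elt xs q) * (chi (elt xs p) - chi (elt xs q)) $ a)"
  proof -
    have "elt xs p \<noteq> elt xs q" if "p \<in> {1..N}" "q \<in> {Suc p..N}" for p q
      using that elt_eq_iff[of p q] by auto
    then show ?thesis unfolding sum_pos_roots by (intro sum.cong refl) (simp add: c)
  qed
  finally show ?thesis .
qed

lemma pairing_hvec_eta:
  fixes \<beta> :: "('m, 'n) weight"
  shows "pairing \<beta> (hvec eta) = \<beta> $ first_index + \<beta> $ last_index"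
proof -
  have "form (chi a) \<beta> = sg a * \<beta> $ a" for a :: "'m + 'n"
  proof -
    have "form (chi a) \<beta> = (\<Sum>b\<in>UNIV. if b = a then sg a * \<beta> $ a else 0)"
      unfolding form_def chi_def axis_def sg_def by (intro sum.cong) auto
    then show ?thesis by simp
  qed
  moreover have "form eta \<beta> = form (chi first_index) \<beta> - form (chi last_index) \<beta>"
    by (simp add: form_def eta_def algebra_simps sum_subtractf)
  moreover have "sg (first_index :: 'm + 'n) = 1" "sg (last_index :: 'm + 'n) = - 1"
    by (simp_all add: sg_def first_index_def last_index_def)
  ultimately show ?thesis by (simp add: pairing_hvec)
qed

lemma pairing_rho_eta: "pairing (rho xs) (hvec eta) = sign_sum (N - 1) - 1"
proof -
  let ?s = "\<lambda>p. sg (elt xs p)"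
  have chi: "chi (elt xs p) $ elt xs r = (if p = r then 1 else 0)"
    if "p \<in> {1..N}" "r \<in> {1..N}" for p r
    using that elt_eq_iff by (auto simp: chi_def axis_def)
  \<comment> \<open>Only roots with p = 1 have a nonzero coordinate at x_1, and only those with q =
    N have one at x_N.\<close>
  have "rho xs $ elt xs 1 = (\<Sum>p = 1..N. if p = 1 then \<Sum>q = 2..N. ?s q else 0) / 2"
    unfolding rho_component using N_ge_2 sg_first
    by (intro arg_cong[of _ _ "\<lambda>x. x / 2"] sum.cong refl)
      (auto simp: chi numeral_2_eq_2 intro!: sum.cong sum.neutral)
  then have first: "rho xs $ elt xs 1 = (\<Sum>q = 2..N. ?s q) / 2"
    using N_ge_2 by simp
  have "rho xs $ elt xs N = (\<Sum>p = 1..N. if p < N then ?s p else 0) / 2"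
  proof -
    have "(\<Sum>q = Suc p..N. ?s p * ?s q * (chi (elt xs p) - chi (elt xs q)) $ elt xs N)
        = (if p < N then ?s p else 0)" if "p \<in> {1..N}" for p
    proof -
      have "(\<Sum>q = Suc p..N. ?s p * ?s q * (chi (elt xs p) - chi (elt xs q)) $ elt xs N)
          = (\<Sum>q = Suc p..N. if q = N then ?s p else 0)"
        using that sg_last by (intro sum.cong refl) (auto simp: chi)
      then show ?thesis using that by simp
    qed
    then show ?thesis unfolding rho_component by simp
  qed
  also have "(\<Sum>p = 1..N. if p < N then ?s p else 0) = sign_sum (N - 1)"
    unfolding sign_sum_def by (rule sum.mono_neutral_cong_right) auto
  finally have last: "rho xs $ elt xs N = sign_sum (N - 1) / 2" .
  \<comment> \<open>\<open>sign_sum N\<close> exceeds the left side by the sign 1 of x_1 and falls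
    short of \<open>sign_sum (N - 1)\<close> by 1, the sign of x_N being -1.\<close>
  have rest: "(\<Sum>q = 2..N. ?s q) = sign_sum (N - 1) - 2"
  proof -
    obtain M where M: "N = Suc M" "1 \<le> M" using N_ge_2 by (cases N) auto
    have "sign_sum N = ?s 1 + (\<Sum>q = 2..N. ?s q)"
      unfolding sign_sum_def using N_ge_2 by (simp add: sum.atLeast_Suc_atMost numeral_2_eq_2)
    moreover have "sign_sum N = sign_sum (N - 1) + ?s N" unfolding sign_sum_def M by simp
    ultimately show ?thesis unfolding sg_first sg_last by (simp add: algebra_simps)
  qed
  show ?thesis
    unfolding pairing_hvec_eta elt_first[symmetric] elt_N[symmetric] first last rest
    by (simp add: diff_divide_distrib)
qed

section \<open>From partial sums to \<open>Theta\<close>, and from simple to all positive root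
  vectors\<close>

abbreviation Z :: "('m, 'n) Ugl" where
  "Z \<equiv> hU (hvec eta) + cst (pairing (rho xs) (hvec eta))"

lemma E_simple_Theta:
  assumes "1 \<le> k" "k < N"
  shows "\<exists>u. E k (Suc k) * Theta xs - u * Z \<in> L"
proof (cases "Suc k = N")
  case True
  have k: "N - 1 = k" using True by simp
  define z where "z = Z"
  have "t_elt xs k = - z"
    unfolding z_def hU_hvec_eta pairing_rho_eta k using t_elt_eq[OF assms] True sg_last
    by (auto simp: cst_minus cst_1)
  then have "E k (Suc k) * Theta xs - (partial_Theta k * - cst (sg (elt xs k) * sg (elt xs N))) * z \<in> L"
    using E_simple_partial_Theta[OF assms, of N] True N_ge_2 by (simp add: Theta_eq mult.assoc)
  then show ?thesis unfolding z_def by blast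
next
  case False
  then show ?thesis
    using E_simple_partial_Theta[OF assms, of N] N_ge_2 by (intro exI[of _ 0]) (simp add: Theta_eq)
qed

text \<open>\<open>E p (Suc q)\<close> is the supercommutator of \<open>E p q\<close> and a simple
  root vector, and the elements \<open>u * Z\<close> plus \<open>L\<close> form a left
  ideal.\<close>

lemma E_pos_Theta:
  assumes "1 \<le> p" "p < q" "q \<le> N"
  shows "\<exists>u. E p q * Theta xs - u * Z \<in> L"
  using assms(2,3)
proof (induction q)
  case (Suc q)
  show ?case
  proof (cases "p = q")
    case True
    then show ?thesis using E_simple_Theta[of p] Suc.prems assms by simp
  next
    case False
    with Suc obtain u where u: "E p q * Theta xs - u * Z \<in> L" by auto
    obtain v where v: "E q (Suc q) * Theta xs - v * Z \<in> L"
      using E_simple_Theta[of q] Suc.prems assms(1) by auto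
    let ?c = "cst (E_sign p q q (Suc q)) :: ('m, 'n) Ugl"
    have E: "E p (Suc q) = E p q * E q (Suc q) - ?c * (E q (Suc q) * E p q)"
      using E_commute[of p q q "Suc q"] Suc.prems assms(1) by simp
    have "E p (Suc q) * Theta xs - (E p q * v - ?c * E q (Suc q) * u) * Z
        = E p q * (E q (Suc q) * Theta xs - v * Z)
          - ?c * E q (Suc q) * (E p q * Theta xs - u * Z)"
      unfolding E by (simp only: left_diff_distrib right_diff_distrib mult.assoc) simp
    also have "\<dots> \<in> L"
      by (intro left_ideal_diff left_ideal_mult_left[OF u] left_ideal_mult_left[OF v])
    finally show ?thesis by blast
  qed
qed simp

lemma partial_Theta_in_U_b_minus: "1 \<le> p \<Longrightarrow> p \<le> N \<Longrightarrow> partial_Theta p \<in> U_b_minus xs"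
proof (induction p rule: less_induct)
  case (less p)
  show ?case
  proof (cases "p = 1")
    case True
    then show ?thesis
      using partial_Theta_1 subalg.cst[of 1] by (simp add: cst_1 U_b_minus_def)
  next
    case False
    have "E p q * partial_Theta q * t_prod q p \<in> U_b_minus xs" if "q \<in> {1..<p}" for q
    proof -
      have "E p q \<in> n_minus_basis xs"
        using that less.prems by (auto simp: n_minus_basis_def N_def)
      moreover have "partial_Theta q \<in> U_b_minus xs" "t_prod q p \<in> U_b_minus xs"
        using less that subsetD[OF U_h_subset_U_b_minus t_prod_in_U_h] by auto
      ultimately show ?thesis
        unfolding U_b_minus_def by (intro subalg.mult) (auto intro: subalg.base)
    qed
    then show ?thesis
      using partial_Theta_rec[of p] False less.prems by (auto simp: U_b_minus_def intro!: subalg_sum)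
  qed
qed

lemma Theta_weight: "hU h * Theta xs - Theta xs * hU h = cst (- pairing eta h) * Theta xs"
proof -
  have "pairing eta h = h $ elt xs 1 - h $ elt xs N"
    using pairing_chi[of _ h] unfolding elt_first elt_N eta_def pairing_def
    by (simp add: left_diff_distrib sum_subtractf)
  moreover have "(\<Sum>c\<in>UNIV. h $ c * ((if c = elt xs N then 1 else 0) - (if c = elt xs 1 then 1 else 0)))
      = h $ elt xs N - h $ elt xs 1"
    by (simp add: right_diff_distrib sum_subtractf if_distrib[of "\<lambda>x. _ * x"] cong: if_cong)
  ultimately show ?thesis
    using has_weight_hU[OF has_weight_partial_Theta[of N], of h] N_ge_2 by (simp add: Theta_eq)
qed

subsection \<open>Partitions\<close>

lemma chain_facts:
  assumes "J \<in> index_sets"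
  shows "distinct (chain xs J)" "set (chain xs J) = J" "chain xs J \<noteq> []"
    "hd (chain xs J) = last_index" "last (chain xs J) = first_index"
proof -
  show "distinct (chain xs J)" "set (chain xs J) = J"
    using distinct_xs set_xs by (auto simp: chain_def)
  then show "chain xs J \<noteq> []" using assms by (auto simp: index_sets_def)
  have ne: "xs \<noteq> []" using N_ge_2 by (auto simp: N_def)
  have "xs ! 0 = first_index" using elt_first by (simp add: elt_def)
  then obtain ys where ys: "xs = first_index # ys" using ne by (cases xs) auto
  have "last xs = last_index" using elt_N ne by (simp add: elt_def N_def last_conv_nth)
  then obtain zs where zs: "xs = zs @ [last_index]"
    using ne by (metis append_butlast_last_id)
  show "hd (chain xs J) = last_index"
    using assms unfolding chain_def by (subst zs) (simp add: index_sets_def)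
  show "last (chain xs J) = first_index"
    using assms unfolding chain_def by (subst ys) (simp add: index_sets_def)
qed

definition indicator_partition :: "('m + 'n) set \<Rightarrow> ('m, 'n) weight \<Rightarrow> nat" where
  "indicator_partition J \<alpha> = (if \<alpha> \<in> set (chain_roots xs J) then 1 else 0)"

text \<open>J can be read off: its elements other than x_1 are the indices subtracted in its chain
  roots. As x_1 ends every chain, it is inserted separately.\<close>

lemma inj_indicator_partition: "inj_on indicator_partition index_sets"
proof (rule inj_on_inverseI)
  fix J :: "('m + 'n) set" assume J: "J \<in> index_sets"
  let ?c = "chain xs J"
  have roots: "set (chain_roots xs J) = {chi b - chi a | a b. (a, b) \<in> set (zip ?c (tl ?c))}"
    by (auto simp: chain_roots_def)
  have "a \<in> J" if ba: "b \<noteq> a" "indicator_partition J (chi b - chi a) = 1" for a b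
  proof -
    obtain a' b' where *: "chi b - chi a = chi b' - chi a'" "(a', b') \<in> set (zip ?c (tl ?c))"
      using ba(2) roots by (auto simp: indicator_partition_def split: if_splits)
    then show ?thesis
      using chi_diff_inject[OF ba(1) *(1)] chain_facts(2)[OF J] by (auto dest: set_zip_leftD)
  qed
  moreover have "\<exists>b. b \<noteq> a \<and> indicator_partition J (chi b - chi a) = 1"
    if "a \<in> J" "a \<noteq> first_index" for a
  proof -
    have "?c = butlast ?c @ [first_index]"
      using append_butlast_last_id[OF chain_facts(3)[OF J]] chain_facts(5)[OF J] by simp
    then have "a \<in> set (butlast ?c @ [first_index])"
      using that(1) chain_facts(2)[OF J] by simp
    then have "a \<in> set (butlast ?c)"
      using that(2) by simp
    then have "a \<in> fst ` set (zip ?c (tl ?c))"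
      unfolding map_fst_zip_tl[symmetric] set_map .
    then obtain b where b: "(a, b) \<in> set (zip ?c (tl ?c))"
      by auto
    then have "chi b - chi a \<in> set (chain_roots xs J)"
      unfolding roots by blast
    moreover have "b \<noteq> a"
      using zip_tl_neq[OF chain_facts(1)[OF J] b] by simp
    ultimately show ?thesis
      unfolding indicator_partition_def by (intro exI[of _ b]) simp
  qed
  ultimately show "insert first_index
      {a. \<exists>b. b \<noteq> a \<and> indicator_partition J (chi b - chi a) = 1} = J"
    using J by (auto simp: index_sets_def)
qed

text \<open>By \<open>f_compatible\<close>, the factors of exponent 1 occur along rs in the same
  order as in the chain.\<close>

lemma e_minus_indicator_partition:
  assumes "root_order xs rs" "f_compatible xs rs" "J \<in> index_sets"
  shows "e_minus rs (indicator_partition J) = f_elt xs J"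
proof -
  let ?c = "chain xs J"
  have "filter (\<lambda>\<alpha>. \<alpha> \<in> set (chain_roots xs J)) rs = chain_roots xs J"
    using assms by (intro filter_in_subseq) (auto simp: root_order_def f_compatible_def)
  then have "e_minus rs (indicator_partition J)
      = prod_list (map (\<lambda>\<alpha>. root_vec (- \<alpha>)) (chain_roots xs J))"
    unfolding e_minus_def indicator_partition_def by (simp add: prod_list_power_indicator)
  also have "map (\<lambda>\<alpha>. root_vec (- \<alpha>)) (chain_roots xs J) = map2 eU ?c (tl ?c)"
    using zip_tl_neq[OF chain_facts(1)[OF assms(3)]]
    by (auto simp: chain_roots_def root_vec_eq)
  finally show ?thesis by (simp add: f_elt_def)
qed

lemma indicator_partition_in_partitions:
  assumes "root_order xs rs" "f_compatible xs rs" "J \<in> index_sets"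
  shows "indicator_partition J \<in> partitions xs eta"
proof -
  let ?r = "chain_roots xs J"
  have sub: "subseq ?r rs" and rs: "distinct rs" "set rs = pos_roots xs"
    using assms by (auto simp: f_compatible_def root_order_def)
  have r: "?r = filter (\<lambda>\<alpha>. \<alpha> \<in> set ?r) rs"
    using filter_in_subseq[OF sub rs(1)] by simp
  have distinct: "distinct ?r"
    by (subst r) (simp add: rs(1))
  have subset: "set ?r \<subseteq> pos_roots xs"
    by (subst r) (auto simp: rs(2))
  have "(\<Sum>\<alpha>\<in>pos_roots xs. of_nat (indicator_partition J \<alpha>) *s \<alpha>) = (\<Sum>\<alpha>\<in>set ?r. \<alpha>)"
    using subset finite_pos_roots by (intro sum.mono_neutral_cong_right) (auto simp: indicator_partition_def)
  also have "\<dots> = eta"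
    using sum_list_chi_differences[of "chain xs J"] chain_facts[OF assms(3)]
    unfolding distinct_sum_list_conv_Sum[OF distinct, symmetric]
    by (simp add: chain_roots_def eta_def)
  finally show ?thesis
    using subset by (auto simp: partitions_def indicator_partition_def)
qed

text \<open>On the root lattice, \<open>height k\<close> is the coefficient of the \<open>k\<close>-th simple root.\<close>

definition height :: "nat \<Rightarrow> ('m, 'n) weight \<Rightarrow> complex" where
  "height k v = (\<Sum>i = 1..k. v $ elt xs i)"

lemma height_root:
  assumes "p \<in> {1..N}" "q \<in> {1..N}" "k \<le> N"
  shows "height k (chi (elt xs p) - chi (elt xs q))
    = (if p \<le> k then 1 else 0) - (if q \<le> k then 1 else 0)"
proof -
  have "(\<Sum>i = 1..k. chi (elt xs p) $ elt xs i) = (if p \<le> k then 1 else 0)"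
    if "p \<in> {1..N}" for p
  proof -
    have "(\<Sum>i = 1..k. chi (elt xs p) $ elt xs i) = (\<Sum>i = 1..k. if i = p then 1 else 0)"
      using that assms(3) by (intro sum.cong) (auto simp: elt_eq_iff chi_def axis_def)
    then show ?thesis using that by simp
  qed
  with assms show ?thesis by (simp add: height_def sum_subtractf)
qed

text \<open>Every simple root has coefficient 1 in eta and 0 or 1 in a positive root. Comparing the
  k-th coefficients leaves a single root of height 1, used once.\<close>

lemma sum_partition_height_1:
  assumes "\<pi> \<in> partitions xs eta" "1 \<le> k" "k < N"
  shows "(\<Sum>\<alpha>\<in>{\<alpha>\<in>pos_roots xs. height k \<alpha> = 1}. \<pi> \<alpha>) = 1"
proof -
  have "height k \<alpha> = 0 \<or> height k \<alpha> = 1" if "\<alpha> \<in> pos_roots xs" for \<alpha>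
    using that assms(3) by (auto simp: pos_roots_def height_root N_def split: if_splits)
  then have "(\<Sum>\<alpha>\<in>pos_roots xs. of_nat (\<pi> \<alpha>) * height k \<alpha>)
      = (\<Sum>\<alpha>\<in>{\<alpha>\<in>pos_roots xs. height k \<alpha> = 1}. of_nat (\<pi> \<alpha>))"
    using finite_pos_roots by (intro sum.mono_neutral_cong_right) auto
  moreover have "(\<Sum>\<alpha>\<in>pos_roots xs. of_nat (\<pi> \<alpha>) * height k \<alpha>)
      = height k (\<Sum>\<alpha>\<in>pos_roots xs. of_nat (\<pi> \<alpha>) *s \<alpha>)"
    unfolding height_def by (simp add: sum_component sum_distrib_left sum.swap[of _ "pos_roots xs"])
  moreover have "\<dots> = height k (chi (elt xs 1) - chi (elt xs N))"
    using assms(1) by (simp only: partitions_def mem_Collect_eq eta_def elt_first elt_N)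
  moreover have "\<dots> = 1" using height_root[of 1 N k] assms(2,3) by simp
  ultimately have "of_nat (\<Sum>\<alpha>\<in>{\<alpha>\<in>pos_roots xs. height k \<alpha> = 1}. \<pi> \<alpha>) = (1::complex)"
    by simp
  then show ?thesis by (simp only: of_nat_eq_1_iff)
qed

text \<open>A root starting at position p has height 1 at p, so the preceding count bounds all
  multiplicities, also those of even roots, by 1.\<close>

lemma finite_partitions: "finite (partitions xs eta)"
proof (rule finite_subset)
  show "partitions xs eta
      \<subseteq> {\<pi>. \<forall>\<alpha>. (\<alpha> \<in> pos_roots xs \<longrightarrow> \<pi> \<alpha> \<in> {..1}) \<and> (\<alpha> \<notin> pos_roots xs \<longrightarrow> \<pi> \<alpha> = 0)}"
  proof (intro subsetI CollectI allI conjI impI)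
    fix \<pi> \<alpha> assume \<pi>: "\<pi> \<in> partitions xs eta"
    show "\<pi> \<alpha> = 0" if "\<alpha> \<notin> pos_roots xs" using \<pi> that by (simp add: partitions_def)
    assume \<alpha>: "\<alpha> \<in> pos_roots xs"
    then obtain p q where pq: "\<alpha> = chi (elt xs p) - chi (elt xs q)" "1 \<le> p" "p < q" "q \<le> N"
      by (auto simp: pos_roots_def N_def)
    then have "height p \<alpha> = 1" by (simp add: height_root)
    then have "\<pi> \<alpha> \<le> (\<Sum>\<alpha>\<in>{\<alpha>\<in>pos_roots xs. height p \<alpha> = 1}. \<pi> \<alpha>)"
      using \<alpha> finite_pos_roots by (intro member_le_sum) auto
    then show "\<pi> \<alpha> \<in> {..1}"
      using sum_partition_height_1[OF \<pi>, of p] pq by simp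
  qed
qed (intro finite_set_of_finite_funs; simp add: finite_pos_roots)

text \<open>The full chain is xs reversed, so its steps are the simple roots in reverse order. Thus
  \<open>UNIV\<close> is the index set belonging to the partition supported on simple roots.\<close>

lemma chain_roots_UNIV: "set (chain_roots xs UNIV) = simple_roots xs"
proof -
  have eq: "chain_roots xs UNIV = map2 (\<lambda>a b. chi b - chi a) (rev xs) (tl (rev xs))"
    by (simp add: chain_roots_def chain_def)
  have nth: "chain_roots xs UNIV ! i = simple_root xs (N - Suc i)" if "i \<in> {..<N - 1}" for i
    using that by (simp add: eq simple_root_def elt_def N_def nth_tl rev_nth Suc_diff_Suc)
  have "set c = (!) c ` {..<length c}" for c :: "('m, 'n) weight list"
    by (auto simp: in_set_conv_nth)
  moreover have "length (chain_roots xs UNIV) = N - 1"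
    by (simp add: eq N_def)
  ultimately have "set (chain_roots xs UNIV) = (!) (chain_roots xs UNIV) ` {..<N - 1}"
    by metis
  also have "\<dots> = (\<lambda>i. simple_root xs (N - Suc i)) ` {..<N - 1}"
    by (rule image_cong[OF refl nth])
  also have "\<dots> = simple_root xs ` (\<lambda>i. N - Suc i) ` {..<N - 1}"
    by (simp add: image_image)
  also have "(\<lambda>i. N - Suc i) ` {..<N - 1} = {1..N - 1}"
  proof (intro equalityI subsetI)
    fix k assume "k \<in> {1..N - 1}"
    then show "k \<in> (\<lambda>i. N - Suc i) ` {..<N - 1}"
      by (intro image_eqI[of _ _ "N - Suc k"]) auto
  qed auto
  finally show ?thesis by (simp add: simple_roots_def N_def)
qed

text \<open>Only the k-th simple root has \<open>height k\<close> equal to 1, so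
  \<open>sum_partition_height_1\<close> forces its multiplicity to be 1. The normalization then
  holds because \<open>H_elt xs UNIV\<close> is an empty product.\<close>

lemma simple_partition_eq:
  assumes "\<pi> \<in> partitions xs eta" "\<forall>\<alpha>. \<alpha> \<notin> simple_roots xs \<longrightarrow> \<pi> \<alpha> = 0"
  shows "\<pi> = indicator_partition UNIV"
proof
  fix \<alpha>
  show "\<pi> \<alpha> = indicator_partition UNIV \<alpha>"
  proof (cases "\<alpha> \<in> simple_roots xs")
    case False
    then show ?thesis using assms(2) by (simp add: indicator_partition_def chain_roots_UNIV)
  next
    case True
    have "{1..length xs - 1} = {1..<N}"
      using N_ge_2 unfolding N_def by auto
    then have simple_roots: "simple_roots xs = simple_root xs ` {1..<N}"
      by (simp only: simple_roots_def)
    with True obtain k where k: "k \<in> {1..<N}" "\<alpha> = simple_root xs k"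
      by blast
    have height: "height k (simple_root xs l) = (if l = k then 1 else 0)" if "l \<in> {1..<N}" for l
      using that k(1) height_root[of l "Suc l" k] by (auto simp: simple_root_def)
    have "\<pi> \<beta> = 0" if "\<beta> \<noteq> \<alpha>" "height k \<beta> = 1" for \<beta>
    proof (rule ccontr)
      assume "\<pi> \<beta> \<noteq> 0"
      with assms(2) have "\<beta> \<in> simple_roots xs" by auto
      then obtain l where l: "l \<in> {1..<N}" "\<beta> = simple_root xs l"
        unfolding simple_roots by (rule imageE)
      then have "l = k" using height[OF l(1)] that(2) by (simp split: if_splits)
      then show False using l(2) k(2) that(1) by simp
    qed
    moreover have "\<alpha> \<in> {\<alpha> \<in> pos_roots xs. height k \<alpha> = 1}"
    proof -
      have "\<alpha> \<in> pos_roots xs"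
        unfolding pos_roots_def mem_Collect_eq
        by (rule exI[of _ k], rule exI[of _ "Suc k"]) (use k in \<open>auto simp: simple_root_def N_def\<close>)
      then show ?thesis using k height[of k] by simp
    qed
    ultimately have "(\<Sum>\<alpha>\<in>{\<alpha>\<in>pos_roots xs. height k \<alpha> = 1}. \<pi> \<alpha>) = (\<Sum>\<beta>\<in>{\<alpha>}. \<pi> \<beta>)"
      using finite_pos_roots by (intro sum.mono_neutral_right) auto
    then show ?thesis
      using sum_partition_height_1[OF assms(1), of k] k True
      by (simp add: indicator_partition_def chain_roots_UNIV)
  qed
qed

lemma Theta_partition_sum:
  assumes "root_order xs rs" "f_compatible xs rs"
  shows "\<exists>H. (\<forall>\<pi>\<in>partitions xs eta. H \<pi> \<in> U_h)
    \<and> (\<forall>\<pi>\<in>partitions xs eta. (\<forall>\<alpha>. \<alpha> \<notin> simple_roots xs \<longrightarrow> \<pi> \<alpha> = 0) \<longrightarrow> H \<pi> = 1)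
    \<and> Theta xs = (\<Sum>\<pi>\<in>partitions xs eta. e_minus rs \<pi> * H \<pi>)"
proof -
  let ?P = "indicator_partition"
  \<comment> \<open>Extension by 0 off the image of the index sets lets the sum over partitions
    collapse to the sum defining \<open>Theta\<close>; injectivity makes the values on the image the
    right ones.\<close>
  define H :: "(('m, 'n) weight \<Rightarrow> nat) \<Rightarrow> ('m, 'n) Ugl"
    where "H \<pi> = (if \<pi> \<in> ?P ` index_sets then H_elt xs (inv_into index_sets ?P \<pi>) else 0)" for \<pi>
  have H: "H (?P J) = H_elt xs J" if "J \<in> index_sets" for J
    using that inj_indicator_partition by (simp add: H_def)
  have "H_elt xs J \<in> U_h" for J
    unfolding H_elt_def by (rule prod_list_t_elt_in_U_h)
  moreover have "(0 :: ('m, 'n) Ugl) \<in> U_h"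
    using cst_in_U_h[of 0] by (simp only: cst_0)
  ultimately have "H \<pi> \<in> U_h" for \<pi>
    by (simp add: H_def)
  moreover have "H \<pi> = 1"
    if "\<pi> \<in> partitions xs eta" "\<forall>\<alpha>. \<alpha> \<notin> simple_roots xs \<longrightarrow> \<pi> \<alpha> = 0" for \<pi>
    using simple_partition_eq[OF that] H[of UNIV] by (simp add: index_sets_def H_elt_def)
  moreover have "Theta xs = (\<Sum>\<pi>\<in>partitions xs eta. e_minus rs \<pi> * H \<pi>)"
  proof -
    have "(\<Sum>\<pi>\<in>partitions xs eta. e_minus rs \<pi> * H \<pi>) = (\<Sum>\<pi>\<in>?P ` index_sets. e_minus rs \<pi> * H \<pi>)"
      using indicator_partition_in_partitions[OF assms] finite_partitions
      by (intro sum.mono_neutral_right) (auto simp: H_def)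
    also have "\<dots> = (\<Sum>J\<in>index_sets. e_minus rs (?P J) * H (?P J))"
      by (simp add: sum.reindex[OF inj_indicator_partition])
    also have "\<dots> = Theta xs"
      unfolding Theta_def using H e_minus_indicator_partition[OF assms] by (intro sum.cong) auto
    finally show ?thesis by simp
  qed
  ultimately show ?thesis by blast
qed

end

theorem theorem3p7:
  fixes xs :: "('m::{finite,linorder} + 'n::{finite,linorder}) list"
    and rs :: "('m, 'n) weight list"
  assumes "shuffle xs"
    and "elt xs 1 = first_index"
    and "elt xs (CARD('m) + CARD('n)) = last_index"
    and "root_order xs rs"
    and "f_compatible xs rs"
  shows "sapovalov xs rs eta (Theta xs)"
proof -
  interpret shuffle_order xs
    using assms(1-3) by unfold_locales
  have "\<exists>u. \<exists>v\<in>L. root_vec \<alpha> * Theta xs = u * Z + v" if \<alpha>: "\<alpha> \<in> pos_roots xs" for \<alpha>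
  proof -
    obtain p q where pq: "1 \<le> p" "p < q" "q \<le> N" "\<alpha> = chi (elt xs p) - chi (elt xs q)"
      using \<alpha> by (auto simp: pos_roots_def N_def)
    then have "root_vec \<alpha> = E p q"
      using elt_eq_iff[of p q] by (simp add: root_vec_eq)
    moreover obtain u where "E p q * Theta xs - u * Z \<in> L"
      using E_pos_Theta[OF pq(1-3)] by blast
    \<comment> \<open>The required element of the left ideal is the difference itself.\<close>
    moreover have "E p q * Theta xs = u * Z + (E p q * Theta xs - u * Z)"
      by simp
    ultimately show ?thesis by metis
  qed
  moreover have "Theta xs \<in> U_b_minus xs"
    using partial_Theta_in_U_b_minus[of N] N_ge_2 by (simp add: Theta_eq)
  ultimately show ?thesis
    unfolding sapovalov_def
    using Theta_weight Theta_partition_sum[OF assms(4,5)] by blast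
qed

end
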